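(* Let $N=2k$ with $k\ge 3$ odd, and let $P$ be a regular $N$-gon with side length $s$, centered at the origin, with a horizontal bottom edge. Write $\mathrm{scale}_n[j]$ for the $j$-th scale of a regular $n$-gon and $\mathrm{GenScale}[n]$ for its last scale. (i) The number of scales of $N=2k$ is $k-1$, with $\mathrm{scale}_{2k}[k-1]=\mathrm{GenScale}[2k]$ and $\mathrm{scale}_{2k}[k-2]=\mathrm{GenScale}[k]$. Therefore the tile $S[k-2]$ of $P$ is a regular $k$-gon with the same side length $s$ as $P$, and $S[k-2]$ and $P$ are in the canonical $M$–$D$ relationship, in the sense that each generates the other: $S[k-2]$ is a tile of the outer billiards map of $P$, and $P$ (in its given position) is the $D$ tile of the outer billiards map whose generating polygon is the regular $k$-gon $S[k-2]$. (ii) Consequently the regular $2k$-gon and the regular $k$-gon have equivalent scales: the First Family of $N=2k$ is symmetric with respect to $S[k-2]$ (reflection in the vertical line through the center of $S[k-2]$ interchanges $S[j]$ and $DS[j]$), so the number of effective scales is $\lfloor k/2\rfloor$, and the odd-indexed scales of $2k$ map to the $\lfloor k/2\rfloor$ scales of $k$ by $$\frac{\mathrm{GenScale}[k]}{\mathrm{scale}_{2k}[2n-1]}=\mathrm{scale}_k\big[\lfloor k/2\rfloor-n+1\big],\qquad n=1,\dots,\lfloor k/2\rfloor .$$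
   Context: Outer billiards: let $Q$ be a regular $n$-gon with vertices $c_1,\dots,c_n$ in clockwise order (indices mod $n$). The edge $c_ic_{i+1}$ has a forward extension (open ray from $c_{i+1}$ in direction $c_{i+1}-c_i$) and a trailing extension (open ray from $c_i$ in direction $c_i-c_{i+1}$). Off $Q$ and the trailing extensions, $\tau(p)=2c_j-p$, where the support vertex is $c_j$ if $p$ lies in the region bounded by the trailing extension of $c_{j-1}c_j$, the edge $c_{j-1}c_j$ and the trailing extension of $c_jc_{j+1}$. Star points and scales: place $Q$ with center at the origin and a horizontal bottom edge traversed from right to left, with left endpoint $v$. The star points are the points at which the extended trailing edges (with their starting vertices) meet the extended horizontal forward edge (the ray going left from $v$, including $v$). They are numbered outwards starting with $\mathrm{star}[1]=v$. There are $m$ of them, with $m=\lfloor n/2\rfloor$ for $n$ odd and $m=n/2-1$ for $n$ even. With $\mathrm{star}[j][[1]]$ the $x$-coordinate of $\mathrm{star}[j]$ and $s$ the side length, $\mathrm{scale}_n[j]=\dfrac{s}{-2\,\mathrm{star}[j][[1]]}$ for $1\le j\le m$ (independent of the size of $Q$), and $\mathrm{GenScale}[n]=\mathrm{scale}_n[m]$. Tiles: write $v=c_j$, and let $U$ be the region bounded by the forward extension of $c_{j-1}c_j$ (horizontal, going left), the edge $c_jc_{j+1}$ and the forward extension of $c_jc_{j+1}$. For $1\le \ell\le m$, the tile $S[\ell]$ is the set of points $p\in U$ such that for every $i\ge 0$ the point $\tau^i(p)$ is in the domain of $\tau$ with support vertex $c_{j+(i+1)\ell}$ (orbits advancing $\ell$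 vertices at each step). The last tile $S[m]$ is also called the $D$ tile of $Q$; by rotating $Q$ through multiples of $2\pi/n$ one obtains $n$ congruent copies of each $S[\ell]$, also called by the same name. When $n=2k$ is even, $D=S[k-1]$ is a translate of $Q$, with center $cD$. $DS[j]$ denotes the tile of $D$ in mirror-image position, i.e. $DS[j]=cD+\sigma(S[j])$ with $\sigma(x,y)=(-x,y)$. The First Family of $n=2k$ is the collection of the $S[j]$ and the $DS[j]$. *)

theory Defs
  imports "HOL-Analysis.Analysis"
begin

section \<open>Regular polygons\<close>

text \<open>The plane is the type of complex numbers. A polygon is given by its vertices
  \<open>c :: int \<Rightarrow> complex\<close>, listed clockwise; indexing by the integers renders ``indices mod n''.\<close>

definition regular_ngon :: "nat \<Rightarrow> complex \<Rightarrow> (int \<Rightarrow> complex) \<Rightarrow> bool" where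
  "regular_ngon n z c \<longleftrightarrow> n \<ge> 3 \<and>
     (\<exists>R \<phi>. R > 0 \<and>
       (\<forall>i. c i = z + complex_of_real R * cis (\<phi> - 2 * pi * real_of_int i / real n)))"

definition side_length :: "(int \<Rightarrow> complex) \<Rightarrow> real" where
  "side_length c = dist (c 0) (c 1)"

definition polygon :: "(int \<Rightarrow> complex) \<Rightarrow> complex set" where
  "polygon c = convex hull (range c)"

text \<open>Centre at the origin, and the edge from \<open>c (-1)\<close> to \<open>c 0\<close> is horizontal and traversed from
  right to left. As the vertices are listed clockwise, this is the bottom edge, and \<open>c 0\<close> is
  its left endpoint \<open>v\<close>.\<close>

definition standard_ngon :: "nat \<Rightarrow> (int \<Rightarrow> complex) \<Rightarrow> bool" where
  "standard_ngon n c \<longleftrightarrow>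
     regular_ngon n 0 c \<and> Im (c (-1)) = Im (c 0) \<and> Re (c 0) < Re (c (-1))"


section \<open>The outer billiards map\<close>

definition forward_ext :: "(int \<Rightarrow> complex) \<Rightarrow> int \<Rightarrow> complex set" where
  "forward_ext c i = {c (i + 1) + complex_of_real t * (c (i + 1) - c i) | t. t > 0}"

definition trailing_ext :: "(int \<Rightarrow> complex) \<Rightarrow> int \<Rightarrow> complex set" where
  "trailing_ext c i = {c i + complex_of_real t * (c i - c (i + 1)) | t. t > 0}"

text \<open>The trailing extension of \<open>c (j - 1)\<close>, \<open>c j\<close> together with that edge is the ray from \<open>c j\<close> in
  direction \<open>c (j - 1) - c j\<close>. Hence the region with support vertex \<open>c j\<close> is the open wedge
  at \<open>c j\<close> between this ray and the trailing extension of \<open>c j\<close>, \<open>c (j + 1)\<close>.\<close>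

definition support_region :: "(int \<Rightarrow> complex) \<Rightarrow> int \<Rightarrow> complex set" where
  "support_region c j =
     {c j + complex_of_real a * (c (j - 1) - c j) + complex_of_real b * (c j - c (j + 1))
        | a b. a > 0 \<and> b > 0}"

definition billiard_domain :: "(int \<Rightarrow> complex) \<Rightarrow> complex set" where
  "billiard_domain c = - (polygon c \<union> (\<Union>i. trailing_ext c i))"

definition support_vertex :: "(int \<Rightarrow> complex) \<Rightarrow> complex \<Rightarrow> complex" where
  "support_vertex c p = (THE w. \<exists>j. w = c j \<and> p \<in> support_region c j)"

text \<open>The value is meaningful on \<open>billiard_domain c\<close> only; orbits that leave the domain are excluded
  explicitly in the definition of the tiles.\<close>

definition outer_billiard :: "(int \<Rightarrow> complex) \<Rightarrow> complex \<Rightarrow> complex" where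
  "outer_billiard c p = 2 * support_vertex c p - p"


section \<open>Star points and scales\<close>

definition num_scales :: "nat \<Rightarrow> nat" where
  "num_scales n = (if even n then n div 2 - 1 else n div 2)"

definition star_points :: "(int \<Rightarrow> complex) \<Rightarrow> complex set" where
  "star_points c =
     (\<Union>i. insert (c i) (trailing_ext c i)) \<inter> insert (c 0) (forward_ext c (-1))"

definition star :: "(int \<Rightarrow> complex) \<Rightarrow> nat \<Rightarrow> complex" where
  "star c j = (THE p. p \<in> star_points c \<and>
     card {q \<in> star_points c. dist (c 0) q \<le> dist (c 0) p} = j)"

definition scale :: "(int \<Rightarrow> complex) \<Rightarrow> nat \<Rightarrow> real" where
  "scale c j = side_length c / (- 2 * Re (star c j))"

definition scales :: "nat \<Rightarrow> (int \<Rightarrow> complex) \<Rightarrow> real set" where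
  "scales n c = scale c ` {1..num_scales n}"

definition GenScale :: "nat \<Rightarrow> (int \<Rightarrow> complex) \<Rightarrow> real" where
  "GenScale n c = scale c (num_scales n)"

definition odd_scales :: "nat \<Rightarrow> (int \<Rightarrow> complex) \<Rightarrow> real set" where
  "odd_scales n c = scale c ` {j \<in> {1..num_scales n}. odd j}"

text \<open>For even \<open>n\<close> the tile \<open>S[j]\<close> has inradius \<open>(s/2) tan (j pi / n)\<close>. So \<open>x = scale[j]\<close> is the size
  of \<open>S[1]\<close> relative to \<open>S[j]\<close>, while \<open>GenScale / x\<close>, which is \<open>scale[n/2 - j]\<close>, is the size of
  \<open>S[j]\<close> relative to the tile \<open>D\<close>. The mirror symmetry of the First Family exchanges the
  polygon and \<open>D\<close>; the two scales are counted as one effective scale.\<close>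

definition scale_class :: "nat \<Rightarrow> (int \<Rightarrow> complex) \<Rightarrow> real \<Rightarrow> real set" where
  "scale_class n c x = {x, GenScale n c / x}"

definition effective_scales :: "nat \<Rightarrow> (int \<Rightarrow> complex) \<Rightarrow> real set set" where
  "effective_scales n c = scale_class n c ` scales n c"


section \<open>Tiles and the First Family\<close>

text \<open>The edge \<open>c j\<close>, \<open>c (j + 1)\<close> and its forward extension form a ray, so the region \<open>U\<close> is again an
  open wedge at \<open>c j\<close>.\<close>

definition tile_region :: "(int \<Rightarrow> complex) \<Rightarrow> int \<Rightarrow> complex set" where
  "tile_region c j =
     {c j + complex_of_real a * (c j - c (j - 1)) + complex_of_real b * (c (j + 1) - c j)
        | a b. a > 0 \<and> b > 0}"

text \<open>\<open>tile c j l\<close> is the tile \<open>S[l]\<close> formed with \<open>c j\<close> in the role of \<open>v\<close>; letting \<open>j\<close> vary gives the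
  rotated copies. For a polygon in standard position, \<open>S[l]\<close> itself is \<open>tile c 0 l\<close>.\<close>

definition tile :: "(int \<Rightarrow> complex) \<Rightarrow> int \<Rightarrow> nat \<Rightarrow> complex set" where
  "tile c j l = {p \<in> tile_region c j. \<forall>i::nat.
     (outer_billiard c ^^ i) p \<in> billiard_domain c \<and>
     (outer_billiard c ^^ i) p \<in> support_region c (j + (int i + 1) * int l)}"

definition D_tile :: "nat \<Rightarrow> (int \<Rightarrow> complex) \<Rightarrow> int \<Rightarrow> complex set" where
  "D_tile n c j = tile c j (num_scales n)"

text \<open>The regions are open, so tiles do not contain their boundary; hence the interior.\<close>

definition cD :: "nat \<Rightarrow> (int \<Rightarrow> complex) \<Rightarrow> complex" where
  "cD n c = (THE w. D_tile n c 0 = (\<lambda>p. w + p) ` interior (polygon c))"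

definition DS :: "nat \<Rightarrow> (int \<Rightarrow> complex) \<Rightarrow> nat \<Rightarrow> complex set" where
  "DS n c j = (\<lambda>p. cD n c + Complex (- Re p) (Im p)) ` tile c 0 j"

definition first_family :: "nat \<Rightarrow> (int \<Rightarrow> complex) \<Rightarrow> complex set set" where
  "first_family n c = tile c 0 ` {1..num_scales n} \<union> DS n c ` {1..num_scales n}"

definition vertical_reflection :: "complex \<Rightarrow> complex \<Rightarrow> complex" where
  "vertical_reflection z p = Complex (2 * Re z - Re p) (Im p)"

end

theory Submission
  imports Defs
begin

text \<open>Let \<open>\<delta> = pi / n\<close>. Everything about a regular \<open>n\<close>-gon reduces to angles that are
  integer multiples of \<open>\<delta>\<close>.

  Scales. The \<open>j\<close>-th star point has abscissa \<open>- r * tan (j * \<delta>)\<close>, where \<open>r\<close> is the inradius,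
  because it is the intersection of two tangents of the incircle (\<open>star_points_eq\<close>). So
  \<open>scale[j]\<close> is \<open>tan \<delta> / tan (j * \<delta>)\<close> (\<open>scale_eq\<close>). All relations between the scales of the
  \<open>2k\<close>-gon and of the \<open>k\<close>-gon then say that two tangents of complementary angles are
  reciprocal.

  Tiles. Suppose that an orbit visits the support vertices \<open>c (j + l)\<close>, \<open>c (j + 2 l)\<close>, and so
  on. There is a point \<open>w\<close> whose orbit under these reflections is a regular star polygon about
  the centre of the \<open>n\<close>-gon, and the displacement of any other point from it changes only its
  sign at each step. Each step requires the point to lie in a wedge bounded by the lines of
  two adjacent edges, and both lines have distance \<open>(s / 2) * tan (l * \<delta>)\<close>, where \<open>s\<close> is the
  side length, from the orbit of \<open>w\<close>. Hence \<open>S[l]\<close> is an intersection of half-planes at this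
  common distance from \<open>w\<close> (\<open>tile_iff_halfplanes\<close>). Evaluating the normals, \<open>S[k - 1]\<close> of the
  \<open>2k\<close>-gon \<open>P\<close> is a translate of \<open>P\<close> (\<open>last_tile\<close>); \<open>S[k - 2]\<close> is a regular \<open>k\<close>-gon \<open>M\<close>, with
  the same side as \<open>P\<close> (\<open>penultimate_tile\<close>); and a last tile of \<open>M\<close> is \<open>P\<close> itself
  (\<open>D_tile_of_M\<close>).

  Symmetry. The centre of \<open>D\<close> is on the horizontal axis, at twice the abscissa of the centre
  of \<open>M\<close>. So reflection in the vertical line through the latter has the same effect as the
  reflection and translation that define \<open>DS[j]\<close> (\<open>reflection_tile\<close>).

  For these computations one needs that the outer billiards map is well defined on the wedges,
  that is, that a point has only one support vertex. This holds because the whole polygon lies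
  on one side of the line from the point through its support vertex
  (\<open>support_region_unique\<close>).\<close>

section \<open>Projections onto directions\<close>

lemma inner_cis_mult_cis: "cis \<theta> \<bullet> (complex_of_real r * cis \<alpha>) = r * cos (\<theta> - \<alpha>)"
  by (simp add: inner_complex_def cos_diff algebra_simps)

lemma inner_cis_rotate: "cis \<theta> \<bullet> (cis \<beta> * x) = cis (\<theta> - \<beta>) \<bullet> x"
  by (simp add: inner_complex_def cos_diff sin_diff algebra_simps)

lemma cis_periodic_int: "cis (\<theta> + real_of_int m * (2 * pi)) = cis \<theta>"
proof -
  have "cis (real_of_int m * (2 * pi)) = 1"
    using cis_multiple_2pi[of "real_of_int m"] by (simp add: mult.commute mult.left_commute)
  then show ?thesis by (simp add: cis_mult[symmetric])
qed

lemma eq_zero_if_two_projections: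
  assumes "cis a \<bullet> x = 0" "cis b \<bullet> x = 0" "sin (a - b) \<noteq> 0"
  shows "x = 0"
proof -
  have 1: "cos a * Re x + sin a * Im x = 0" and 2: "cos b * Re x + sin b * Im x = 0"
    using assms(1,2) by (simp_all add: inner_complex_def)
  have "sin (a - b) * Re x = sin a * (cos b * Re x + sin b * Im x) - sin b * (cos a * Re x + sin a * Im x)"
    by (simp add: sin_diff algebra_simps)
  moreover have "sin (a - b) * Im x = cos b * (cos a * Re x + sin a * Im x) - cos a * (cos b * Re x + sin b * Im x)"
    by (simp add: sin_diff algebra_simps)
  ultimately have "sin (a - b) * Re x = 0" "sin (a - b) * Im x = 0" unfolding 1 2 by simp_all
  then have "Re x = 0" "Im x = 0" using assms(3) by simp_all
  then show ?thesis by (simp add: complex_eq_iff)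
qed

lemma cis_diff_chord: "cis a - cis b = 2 * \<i> * complex_of_real (sin ((a - b) / 2)) * cis ((a + b) / 2)"
  by (simp add: complex_eq_iff sin_diff_sin cos_diff_cos minus_diff_eq[symmetric, of b a]
        del: minus_diff_eq)

section \<open>Regular polygons and their support regions\<close>

locale ngon =
  fixes n :: nat and z :: complex and R \<phi> \<delta> :: real and c :: "int \<Rightarrow> complex"
  assumes n3: "n \<ge> 3" and R_pos: "R > 0"
    and n_delta: "real n * \<delta> = pi"
    and vertex: "\<And>i. c i = z + complex_of_real R * cis (\<phi> - 2 * real_of_int i * \<delta>)"
begin

lemma delta_pos: "\<delta> > 0"
  using n_delta n3 pi_gt_zero by (metis of_nat_0_le_iff zero_less_mult_pos zero_less_mult_pos2 mult_nonneg_nonpos not_less)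

lemma delta_le: "\<delta> \<le> pi / 3"
proof -
  have "3 * \<delta> \<le> real n * \<delta>" using delta_pos n3 by simp
  then show ?thesis using n_delta by simp
qed

lemma sin_delta_pos: "sin \<delta> > 0" and sin_2delta_pos: "sin (2 * \<delta>) > 0"
  and cos_delta_pos: "cos \<delta> > 0"
  using delta_pos delta_le pi_gt_zero by (auto intro!: sin_gt_zero cos_gt_zero)

lemma cos_3delta_less: "cos \<delta> - cos (3 * \<delta>) > 0"
proof -
  have "cos \<delta> - cos (3 * \<delta>) = 2 * sin (2 * \<delta>) * sin \<delta>"
    by (simp add: cos_diff_cos)
  then show ?thesis using sin_delta_pos sin_2delta_pos by simp
qed

lemma inner_vertex: "cis \<theta> \<bullet> (c i - z) = R * cos (\<theta> - \<phi> + 2 * real_of_int i * \<delta>)"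
  by (simp add: vertex inner_cis_mult_cis algebra_simps)

lemma vertex_periodic: "c (i + int n * m) = c i"
proof -
  have "\<phi> - 2 * real_of_int (i + int n * m) * \<delta> = \<phi> - 2 * real_of_int i * \<delta> + real_of_int (- m) * (2 * pi)"
    by (simp add: n_delta[symmetric] algebra_simps)
  then show ?thesis by (simp only: vertex cis_periodic_int)
qed

lemma vertex_cong: "int n dvd i - j \<Longrightarrow> c i = c j"
  using vertex_periodic[of j] by (metis dvdE add.commute diff_add_cancel)

lemma support_region_cong: "int n dvd i - j \<Longrightarrow> support_region c i = support_region c j"
  unfolding support_region_def
  using vertex_cong[of i j] vertex_cong[of "i-1" "j-1"] vertex_cong[of "i+1" "j+1"] by simp

text \<open>Direction of the outward normal of the edge from \<open>c i\<close> to \<open>c (i + 1)\<close>.\<close>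

abbreviation edge_angle :: "int \<Rightarrow> real" where
  "edge_angle i \<equiv> \<phi> - (2 * real_of_int i + 1) * \<delta>"

lemma inner_edge_vertex:
  "cis (edge_angle i) \<bullet> (c m - z) = R * cos ((2 * real_of_int (m - i) - 1) * \<delta>)"
  by (simp only: inner_vertex) (simp add: algebra_simps)

text \<open>The two rays bounding the region lie on the lines of the two edges at \<open>c j\<close>, so the
  oblique coordinates \<open>a\<close>, \<open>b\<close> of a point are positive multiples of its signed distances from
  these lines.\<close>

lemma support_region_iff:
  "p \<in> support_region c j \<longleftrightarrow>
     cis (edge_angle (j - 1)) \<bullet> (p - z) > R * cos \<delta> \<and> cis (edge_angle j) \<bullet> (p - z) < R * cos \<delta>"
proof -
  let ?A = "cis (edge_angle (j - 1))" and ?B = "cis (edge_angle j)"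
  let ?q = "\<lambda>a b. c j + complex_of_real a * (c (j - 1) - c j) + complex_of_real b * (c j - c (j + 1))"
  let ?K = "R * (cos \<delta> - cos (3 * \<delta>))"
  have K: "?K > 0" using R_pos cos_3delta_less by simp
  have v: "?A \<bullet> (c j - z) = R * cos \<delta>" "?A \<bullet> (c (j - 1) - z) = R * cos \<delta>"
     "?A \<bullet> (c (j + 1) - z) = R * cos (3 * \<delta>)" "?B \<bullet> (c j - z) = R * cos \<delta>"
     "?B \<bullet> (c (j + 1) - z) = R * cos \<delta>" "?B \<bullet> (c (j - 1) - z) = R * cos (3 * \<delta>)"
    unfolding inner_edge_vertex using cos_minus[of \<delta>] cos_minus[of "3*\<delta>"] by simp_all
  have dec: "?q a b - z = (c j - z) + (a *\<^sub>R ((c (j - 1) - z) - (c j - z)) + b *\<^sub>R ((c j - z) - (c (j + 1) - z)))" for a b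
    by (simp add: scaleR_conv_of_real)
  have q: "?A \<bullet> (?q a b - z) = R * cos \<delta> + b * ?K" "?B \<bullet> (?q a b - z) = R * cos \<delta> - a * ?K" for a b
    unfolding dec inner_add_right inner_diff_right[of _ "_ - z" "_ - z"] inner_scaleR_right v by (simp_all add: algebra_simps)
  show ?thesis
  proof
    assume "p \<in> support_region c j"
    then obtain a b where "a > 0" "b > 0" "p = ?q a b" unfolding support_region_def by blast
    then show "?A \<bullet> (p - z) > R * cos \<delta> \<and> ?B \<bullet> (p - z) < R * cos \<delta>"
      using K by (simp only: q) simp
  next
    assume h: "?A \<bullet> (p - z) > R * cos \<delta> \<and> ?B \<bullet> (p - z) < R * cos \<delta>"
    have div: "x / y * y = x" if "y > 0" for x y :: real using that by simp
    define a where "a = (R * cos \<delta> - ?B \<bullet> (p - z)) / ?K"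
    define b where "b = (?A \<bullet> (p - z) - R * cos \<delta>) / ?K"
    have ab: "a > 0" "b > 0" using h K by (simp_all add: a_def b_def)
    have "a * ?K = R * cos \<delta> - ?B \<bullet> (p - z)" "b * ?K = ?A \<bullet> (p - z) - R * cos \<delta>"
      unfolding a_def b_def using div[OF K] by blast+
    with q[of a b] have "?A \<bullet> (?q a b - z) = ?A \<bullet> (p - z)" "?B \<bullet> (?q a b - z) = ?B \<bullet> (p - z)"
      by simp_all
    then have "?A \<bullet> ((?q a b - z) - (p - z)) = 0" "?B \<bullet> ((?q a b - z) - (p - z)) = 0"
      unfolding inner_diff_right[of _ "_ - z" "p - z"] by simp_all
    moreover have "edge_angle (j - 1) - edge_angle j = 2 * \<delta>" by (simp add: algebra_simps)
    then have "sin (edge_angle (j - 1) - edge_angle j) \<noteq> 0" using sin_2delta_pos by (simp only:)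
    ultimately have "(?q a b - z) - (p - z) = 0" by (rule eq_zero_if_two_projections)
    then have "p = ?q a b" by (metis right_minus_eq diff_add_cancel)
    with ab show "p \<in> support_region c j" unfolding support_region_def by blast
  qed
qed

section \<open>The polygon as an intersection of half-planes\<close>

text \<open>An integer multiple of \<open>\<delta>\<close> may be reduced modulo \<open>pi = n * \<delta>\<close> at the price of a sign.
  The sign is common to all neighbouring multiples, so it disappears from products of two of
  the sines.\<close>

lemma sin_reduce:
  obtains \<epsilon> where "\<epsilon>\<^sup>2 = 1" "\<And>e. sin (real_of_int (d + e) * \<delta>) = \<epsilon> * sin (real_of_int (d mod int n + e) * \<delta>)"
proof
  define m where "m = d div int n"
  show "(cos (real_of_int m * pi))\<^sup>2 = 1" 
    using sin_cos_squared_add[of "real_of_int m * pi"] sin_zero_iff_int2[of "real_of_int m * pi"]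
    by (auto simp: power2_eq_square)
  fix e
  have "real_of_int (d + e) * \<delta> = real_of_int (d mod int n + e) * \<delta> + real_of_int m * pi"
  proof -
    have "d = int n * m + d mod int n" by (simp add: m_def)
    then have "real_of_int d = real n * real_of_int m + real_of_int (d mod int n)"
      by (metis of_int_add of_int_mult of_int_of_nat_eq)
    then show ?thesis by (simp add: n_delta[symmetric] algebra_simps)
  qed
  moreover have "sin (real_of_int m * pi) = 0" using sin_zero_iff_int2 by blast
  ultimately show "sin (real_of_int (d + e) * \<delta>) = cos (real_of_int m * pi) * sin (real_of_int (d mod int n + e) * \<delta>)"
    by (simp add: sin_add)
qed

lemma sin_multiple_nonneg: "0 \<le> d \<Longrightarrow> d \<le> int n \<Longrightarrow> sin (real_of_int d * \<delta>) \<ge> 0"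
proof -
  assume "0 \<le> d" "d \<le> int n"
  then have "real_of_int d * \<delta> \<le> real n * \<delta>" using delta_pos by (simp add: mult_right_mono)
  then show ?thesis using \<open>0 \<le> d\<close> delta_pos n_delta by (intro sin_ge_zero) simp_all
qed

lemma sin_multiple_pos: "0 < d \<Longrightarrow> d < int n \<Longrightarrow> sin (real_of_int d * \<delta>) > 0"
proof -
  assume "0 < d" "d < int n"
  then have "real_of_int d * \<delta> < real n * \<delta>" using delta_pos by (simp add: mult_strict_right_mono)
  then show ?thesis using \<open>0 < d\<close> delta_pos n_delta by (intro sin_gt_zero) simp_all
qed

lemma sin_consecutive_nonneg: "sin (real_of_int d * \<delta>) * sin (real_of_int (d + 1) * \<delta>) \<ge> 0"
proof -
  obtain \<epsilon> where e: "\<epsilon>\<^sup>2 = 1" "\<And>e. sin (real_of_int (d + e) * \<delta>) = \<epsilon> * sin (real_of_int (d mod int n + e) * \<delta>)"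
    using sin_reduce[of d] by blast
  have r: "0 \<le> d mod int n" "d mod int n < int n" using n3 by simp_all
  have "sin (real_of_int d * \<delta>) * sin (real_of_int (d + 1) * \<delta>)
     = \<epsilon>\<^sup>2 * (sin (real_of_int (d mod int n) * \<delta>) * sin (real_of_int (d mod int n + 1) * \<delta>))"
    using e(2)[of 0] e(2)[of 1] by (simp add: power2_eq_square)
  also have "\<dots> \<ge> 0" unfolding e(1) using r by (simp only: mult_1) (intro mult_nonneg_nonneg sin_multiple_nonneg; simp)
  finally show ?thesis .
qed

lemma polygon_subset_halfplane: "polygon c \<subseteq> {p. cis (edge_angle i) \<bullet> (p - z) \<le> R * cos \<delta>}"
  unfolding polygon_def
proof (rule hull_minimal)
  have "{p. cis (edge_angle i) \<bullet> (p - z) \<le> R * cos \<delta>} = {p. cis (edge_angle i) \<bullet> p \<le> R * cos \<delta> + cis (edge_angle i) \<bullet> z}"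
    by (auto simp: inner_diff_right)
  then show "convex {p. cis (edge_angle i) \<bullet> (p - z) \<le> R * cos \<delta>}" by (simp add: convex_halfspace_le)
  show "range c \<subseteq> {p. cis (edge_angle i) \<bullet> (p - z) \<le> R * cos \<delta>}"
  proof clarify
    fix m
    define e where "e = m - i - 1"
    have "cos \<delta> - cos ((2 * real_of_int (m - i) - 1) * \<delta>)
        = 2 * (sin (real_of_int e * \<delta>) * sin (real_of_int (e + 1) * \<delta>))"
    proof -
      have "(\<delta> + (2 * real_of_int (m - i) - 1) * \<delta>) / 2 = real_of_int (e + 1) * \<delta>"
        "((2 * real_of_int (m - i) - 1) * \<delta> - \<delta>) / 2 = real_of_int e * \<delta>"
        by (simp_all add: e_def field_simps)
      then show ?thesis unfolding cos_diff_cos by (simp only:) (simp add: mult.commute)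
    qed
    then have "cos ((2 * real_of_int (m - i) - 1) * \<delta>) \<le> cos \<delta>"
      using sin_consecutive_nonneg[of e] by linarith
    then show "cis (edge_angle i) \<bullet> (c m - z) \<le> R * cos \<delta>"
      unfolding inner_edge_vertex using R_pos by simp
  qed
qed

text
  \<open>A point outside the hull is separated from it by a linear functional. The direction of the functional lies between the normals of two consecutive edges, hence is a nonnegative combination of them, and both normals attain their maximum over the polygon at the common vertex of these edges. So the point violates one of the two edge inequalities.\<close>

lemma interior_polygon: "interior (polygon c) = {p. \<forall>i. cis (edge_angle i) \<bullet> (p - z) < R * cos \<delta>}"
  (is "_ = ?G")
proof (rule equalityI)
  have halfplane: "{p. cis (edge_angle i) \<bullet> (p - z) \<le> R * cos \<delta>} = {p. cis (edge_angle i) \<bullet> p \<le> R * cos \<delta> + cis (edge_angle i) \<bullet> z}" for i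
    by (auto simp: inner_diff_right)
  show "interior (polygon c) \<subseteq> ?G"
  proof clarify
    fix p i assume "p \<in> interior (polygon c)"
    then have "p \<in> interior {p. cis (edge_angle i) \<bullet> (p - z) \<le> R * cos \<delta>}"
      using interior_mono[OF polygon_subset_halfplane[of i]] by blast
    then show "cis (edge_angle i) \<bullet> (p - z) < R * cos \<delta>"
      unfolding halfplane by (subst (asm) interior_halfspace_le) (auto simp: inner_diff_right)
  qed
next
  have "?G = (\<Inter>i\<in>{0..<int n}. {p. cis (edge_angle i) \<bullet> (p - z) < R * cos \<delta>})"
  proof (intro equalityI subsetI CollectI allI; clarsimp)
    fix p i assume h: "\<forall>i\<in>{0..<int n}. cis (edge_angle i) \<bullet> (p - z) < R * cos \<delta>"
    have "edge_angle (i mod int n) = edge_angle i + real_of_int (i div int n) * (2 * pi)"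
    proof -
      have "real_of_int i = real n * real_of_int (i div int n) + real_of_int (i mod int n)"
        by (metis mult_div_mod_eq of_int_add of_int_mult of_int_of_nat_eq)
      then show ?thesis by (simp add: n_delta[symmetric] algebra_simps)
    qed
    then have "cis (edge_angle (i mod int n)) = cis (edge_angle i)" by (simp only: cis_periodic_int)
    then show "cis (edge_angle i) \<bullet> (p - z) < R * cos \<delta>"
      using h n3 by (metis atLeastLessThan_iff pos_mod_bound pos_mod_sign of_nat_0_less_iff zero_less_numeral order_less_le_trans)
  qed
  moreover have "open {p. cis (edge_angle i) \<bullet> (p - z) < R * cos \<delta>}" for i
    by (intro open_Collect_less continuous_intros)
  ultimately have "open ?G" by (simp add: open_INT)
  moreover have "?G \<subseteq> polygon c"
  proof (rule ccontr)
    assume "\<not> ?G \<subseteq> polygon c"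
    then obtain p where p: "\<And>i. cis (edge_angle i) \<bullet> (p - z) < R * cos \<delta>" and "p \<notin> polygon c" by auto
    have "range c = c ` {0..<int n}"
    proof (intro equalityI subsetI; clarsimp)
      fix i
      have "int n dvd i - i mod int n" by (simp add: minus_mod_eq_mult_div)
      then show "c i \<in> c ` {0..<int n}" using n3 vertex_cong[of i "i mod int n"] by auto
    qed
    then have "finite (range c)" by simp
    then have "compact (polygon c)" unfolding polygon_def by (intro compact_convex_hull finite_imp_compact)
    then have "closed (polygon c)" "convex (polygon c)" 
      by (auto intro: compact_imp_closed simp: polygon_def)
    then obtain u b where u: "u \<bullet> p < b" "\<And>x. x \<in> polygon c \<Longrightarrow> u \<bullet> x > b"
      using separating_hyperplane_closed_point \<open>p \<notin> polygon c\<close> by metis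
    have cp: "c i \<in> polygon c" for i unfolding polygon_def by (simp add: hull_inc)
    have "u \<noteq> 0" using u(1) u(2)[OF cp[of 0]] by auto
    define \<theta> where "\<theta> = Arg (- u)"
    have ucis: "- u = norm u *\<^sub>R cis \<theta>" 
      using \<open>u \<noteq> 0\<close> by (simp add: \<theta>_def rcis_cmod_Arg[of "- u", unfolded rcis_def, simplified] scaleR_conv_of_real)
    \<comment> \<open>the index for which \<open>\<theta>\<close> lies between the normals of the two edges at \<open>c i\<close>\<close>
    define i where "i = \<lfloor>(\<phi> - \<theta>) / (2 * \<delta>) + 1 / 2\<rfloor>"
    define s t where "s = sin (\<theta> - edge_angle i)" and "t = sin (edge_angle (i - 1) - \<theta>)"
    have "real_of_int i \<le> (\<phi> - \<theta>) / (2 * \<delta>) + 1 / 2" "(\<phi> - \<theta>) / (2 * \<delta>) + 1 / 2 < real_of_int i + 1"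
      unfolding i_def by linarith+
    then have "(real_of_int i - 1/2) * (2 * \<delta>) \<le> \<phi> - \<theta>" "\<phi> - \<theta> < (real_of_int i + 1/2) * (2 * \<delta>)"
      using delta_pos by (simp_all add: field_simps)
    then have between: "0 \<le> \<theta> - edge_angle i" "0 \<le> edge_angle (i - 1) - \<theta>" "\<theta> - edge_angle i \<le> 2 * \<delta>" "edge_angle (i - 1) - \<theta> \<le> 2 * \<delta>"
      by (simp_all add: algebra_simps)
    then have st: "s \<ge> 0" "t \<ge> 0"
      using delta_le pi_gt_zero unfolding s_def t_def by (auto intro!: sin_ge_zero simp del: of_int_diff)
    have comb: "sin (2 * \<delta>) *\<^sub>R cis \<theta> = s *\<^sub>R cis (edge_angle (i - 1)) + t *\<^sub>R cis (edge_angle i)"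
    proof -
      have gen: "sin (\<beta> - \<alpha>) *\<^sub>R cis \<theta> = sin (\<theta> - \<alpha>) *\<^sub>R cis \<beta> + sin (\<beta> - \<theta>) *\<^sub>R cis \<alpha>" for \<alpha> \<beta>
      proof (rule complex_eqI)
        show "Re (sin (\<beta> - \<alpha>) *\<^sub>R cis \<theta>) = Re (sin (\<theta> - \<alpha>) *\<^sub>R cis \<beta> + sin (\<beta> - \<theta>) *\<^sub>R cis \<alpha>)"
          by (simp add: sin_diff algebra_simps)
        show "Im (sin (\<beta> - \<alpha>) *\<^sub>R cis \<theta>) = Im (sin (\<theta> - \<alpha>) *\<^sub>R cis \<beta> + sin (\<beta> - \<theta>) *\<^sub>R cis \<alpha>)"
          by (simp add: sin_diff algebra_simps)
      qed
      have "edge_angle (i - 1) - edge_angle i = 2 * \<delta>" by (simp add: algebra_simps)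
      then show ?thesis using gen[of "edge_angle (i - 1)" "edge_angle i"] unfolding s_def t_def by (simp only:)
    qed
    have "sin (2 * \<delta>) * (cis \<theta> \<bullet> (p - z)) = s * (cis (edge_angle (i - 1)) \<bullet> (p - z)) + t * (cis (edge_angle i) \<bullet> (p - z))"
      using comb by (metis inner_add_left inner_scaleR_left)
    also have "\<dots> \<le> s * (R * cos \<delta>) + t * (R * cos \<delta>)"
      using st p[of i] p[of "i - 1"] by (intro add_mono mult_left_mono) (auto intro: less_imp_le)
    also have "\<dots> = s * (cis (edge_angle (i - 1)) \<bullet> (c i - z)) + t * (cis (edge_angle i) \<bullet> (c i - z))"
      unfolding inner_edge_vertex using cos_minus[of \<delta>] by simp
    also have "\<dots> = sin (2 * \<delta>) * (cis \<theta> \<bullet> (c i - z))"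
      using comb by (metis inner_add_left inner_scaleR_left)
    finally have "cis \<theta> \<bullet> (p - z) \<le> cis \<theta> \<bullet> (c i - z)" using sin_2delta_pos by simp
    then have "norm u * (cis \<theta> \<bullet> p) \<le> norm u * (cis \<theta> \<bullet> c i)" 
      by (intro mult_left_mono) (simp_all add: inner_diff_right)
    moreover have "norm u * (cis \<theta> \<bullet> x) = - (u \<bullet> x)" for x
      using ucis by (metis inner_scaleR_left inner_minus_left)
    ultimately show False using u(1) u(2)[OF cp[of i]] by simp
  qed
  ultimately show "?G \<subseteq> interior (polygon c)" by (rule interior_maximal[rotated])
qed

section \<open>The support vertex\<close>

lemma sin_neighbours_pos:
  assumes "\<not> int n dvd d" "a > 0" "b > 0"
  shows "sin (real_of_int d * \<delta>) * (a * sin (real_of_int (d + 1) * \<delta>) + b * sin (real_of_int (d - 1) * \<delta>)) > 0"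
proof -
  obtain \<epsilon> where e: "\<epsilon>\<^sup>2 = 1" "\<And>e. sin (real_of_int (d + e) * \<delta>) = \<epsilon> * sin (real_of_int (d mod int n + e) * \<delta>)"
    using sin_reduce[of d] by blast
  define r where "r = d mod int n"
  have r: "0 < r" "r < int n" using n3 assms(1) pos_mod_sign[of "int n" d] pos_mod_bound[of "int n" d]
    by (auto simp add: r_def dvd_eq_mod_eq_0 order_less_le)
  have "sin (real_of_int d * \<delta>) * (a * sin (real_of_int (d + 1) * \<delta>) + b * sin (real_of_int (d - 1) * \<delta>))
     = \<epsilon>\<^sup>2 * (sin (real_of_int r * \<delta>) * (a * sin (real_of_int (r + 1) * \<delta>) + b * sin (real_of_int (r - 1) * \<delta>)))"
    using e(2)[of 0] e(2)[of 1] e(2)[of "-1"] by (simp add: power2_eq_square r_def algebra_simps)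
  moreover have "sin (real_of_int r * \<delta>) > 0" using r by (rule sin_multiple_pos)
  moreover have "a * sin (real_of_int (r + 1) * \<delta>) + b * sin (real_of_int (r - 1) * \<delta>) > 0"
  proof (cases "r = 1")
    case True
    then have "sin (real_of_int (r + 1) * \<delta>) > 0" using n3 by (intro sin_multiple_pos) auto
    then show ?thesis using True assms by simp
  next
    case False
    then have "sin (real_of_int (r - 1) * \<delta>) > 0" "sin (real_of_int (r + 1) * \<delta>) \<ge> 0"
      using r by (auto intro!: sin_multiple_pos sin_multiple_nonneg simp del: of_int_add of_int_diff)
    then show ?thesis using assms by (simp add: add_nonneg_pos)
  qed
  ultimately show ?thesis using e(1) by simp
qed

text \<open>The cross product detects on which side of the line from \<open>p\<close> through \<open>c i\<close> the vertex
  \<open>c m\<close> lies. The three differences of vertices involved are chords of one circle, so their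
  cross products factor into sines of multiples of \<open>\<delta>\<close>.\<close>

lemma cross_vertices:
  assumes p: "p = c i + complex_of_real a * (c (i - 1) - c i) + complex_of_real b * (c i - c (i + 1))"
  shows "Im (cnj (c i - p) * (c m - p)) = - 4 * R\<^sup>2 * sin \<delta> * (sin (real_of_int (m - i) * \<delta>) *
    (a * sin (real_of_int (m - i + 1) * \<delta>) + b * sin (real_of_int (m - i - 1) * \<delta>)))"
proof -
  define y where "y = \<phi> - 2 * real_of_int i * \<delta>"
  define chord where "chord t \<alpha> = 2 * \<i> * complex_of_real (R * t) * cis \<alpha>" for t \<alpha>
  have C: "c m - c i = chord (- sin (real_of_int (m - i) * \<delta>)) (y - real_of_int (m - i) * \<delta>)" for m
  proof -
    have "c m - c i = complex_of_real R * (cis (\<phi> - 2 * real_of_int m * \<delta>) - cis y)"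
      by (simp add: vertex y_def right_diff_distrib)
    moreover have "(\<phi> - 2 * real_of_int m * \<delta> - y) / 2 = - (real_of_int (m - i) * \<delta>)"
      "(\<phi> - 2 * real_of_int m * \<delta> + y) / 2 = y - real_of_int (m - i) * \<delta>"
      by (simp_all add: y_def field_simps)
    ultimately show ?thesis unfolding cis_diff_chord chord_def by (simp only: sin_minus) simp
  qed
  have A: "c (i - 1) - c i = chord (sin \<delta>) (y + \<delta>)"
    using C[of "i - 1"] by simp
  have B: "c i - c (i + 1) = chord (sin \<delta>) (y - \<delta>)"
    using C[of "i + 1"] minus_diff_eq[of "c (i + 1)" "c i"] by (simp add: chord_def)
  have cr: "Im (cnj (chord s \<alpha>) * chord t \<beta>) = 4 * R\<^sup>2 * s * t * sin (\<beta> - \<alpha>)" for s t \<alpha> \<beta>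
    by (simp add: chord_def sin_diff power2_eq_square algebra_simps)
  have self: "Im (cnj u * u) = 0" for u by simp
  have "c i - p = - (of_real a * (c (i - 1) - c i) + of_real b * (c i - c (i + 1)))"
    using p by (simp add: algebra_simps)
  then have u: "c i - p = - (of_real a * chord (sin \<delta>) (y + \<delta>) + of_real b * chord (sin \<delta>) (y - \<delta>))"
    unfolding A B .
  have "Im (cnj (c i - p) * (c m - p)) = Im (cnj (c i - p) * (c m - c i)) + Im (cnj (c i - p) * (c i - p))"
    by (simp add: algebra_simps)
  also have "\<dots> = Im (cnj (c i - p) * (c m - c i))" by (simp only: self)
  also have "\<dots> = - a * Im (cnj (chord (sin \<delta>) (y + \<delta>)) * (c m - c i))
      - b * Im (cnj (chord (sin \<delta>) (y - \<delta>)) * (c m - c i))"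
    unfolding u by (simp add: algebra_simps)
  also have "\<dots> = - 4 * R\<^sup>2 * sin \<delta> * (sin (real_of_int (m - i) * \<delta>) *
    (a * sin (real_of_int (m - i + 1) * \<delta>) + b * sin (real_of_int (m - i - 1) * \<delta>)))"
  proof -
    have s: "y - real_of_int (m - i) * \<delta> - (y + \<delta>) = - (real_of_int (m - i + 1) * \<delta>)"
      "y - real_of_int (m - i) * \<delta> - (y - \<delta>) = - (real_of_int (m - i - 1) * \<delta>)"
      by (simp_all add: algebra_simps)
    show ?thesis unfolding C cr s sin_minus by (simp add: algebra_simps del: of_int_add of_int_diff)
  qed
  finally show ?thesis .
qed

text \<open>This justifies the term support vertex: seen from \<open>p\<close>, all other vertices lie strictly
  on the same side of the line through \<open>p\<close> and \<open>c i\<close>.\<close>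

lemma support_region_cross:
  assumes "p \<in> support_region c i" "\<not> int n dvd m - i"
  shows "Im (cnj (c i - p) * (c m - p)) < 0"
proof -
  obtain a b where ab: "a > 0" "b > 0"
    and p: "p = c i + complex_of_real a * (c (i - 1) - c i) + complex_of_real b * (c i - c (i + 1))"
    using assms(1) unfolding support_region_def by blast
  show ?thesis unfolding cross_vertices[OF p]
    using sin_neighbours_pos[OF assms(2) ab] sin_delta_pos R_pos
    by (simp add: del: of_int_add of_int_diff)
qed

lemma cross_swap: "Im (cnj v * u) = - Im (cnj u * v)"
  by simp

text \<open>If both vertices supported \<open>p\<close>, each would have to lie on the same side of the other,
  which contradicts the antisymmetry of the cross product.\<close>

lemma support_region_unique:
  assumes "p \<in> support_region c i" "p \<in> support_region c j"
  shows "c i = c j"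
proof (rule ccontr)
  assume "c i \<noteq> c j"
  then have "\<not> int n dvd j - i" "\<not> int n dvd i - j" using vertex_cong[of i j] vertex_cong[of j i] by auto
  then show False
    using support_region_cross[OF assms(1), of j] support_region_cross[OF assms(2), of i]
      cross_swap[of "c i - p" "c j - p"] by linarith
qed

text \<open>A point on a trailing extension of \<open>c i\<close> still has the polygon weakly on one side of
  its line to \<open>c i\<close> (the case \<open>a = 0\<close> of the cross product formula). As in the proof of
  uniqueness, it cannot have another support vertex; and \<open>c i\<close> itself is excluded because the
  point is on the line of an edge at \<open>c i\<close>.\<close>

lemma support_region_subset_domain: "support_region c j \<subseteq> billiard_domain c"
proof
  fix p assume p: "p \<in> support_region c j"
  have "p \<notin> polygon c"
    using p polygon_subset_halfplane[of "j - 1"] unfolding support_region_iff by fastforce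
  moreover have "p \<notin> trailing_ext c i" for i
  proof
    assume "p \<in> trailing_ext c i"
    then obtain t where t: "t > 0" "p = c i + complex_of_real t * (c i - c (i + 1))"
      unfolding trailing_ext_def by blast
    then have p_i: "p = c i + complex_of_real 0 * (c (i - 1) - c i) + complex_of_real t * (c i - c (i + 1))" by simp
    show False
    proof (cases "int n dvd i - j")
      case True
      have "p - z = (c i - z) + t *\<^sub>R ((c i - z) - (c (i + 1) - z))"
        using t(2) by (simp add: scaleR_conv_of_real)
      then have "cis (edge_angle i) \<bullet> (p - z) = R * cos \<delta>"
        by (simp only: inner_add_right inner_diff_right[of _ "_ - z" "_ - z"] inner_scaleR_right inner_edge_vertex) simp
      then show False using p True support_region_cong[of i j] support_region_iff[of p i] by auto
    next
      case False
      have "sin (real_of_int (j - i) * \<delta>) * (t * sin (real_of_int (j - i - 1) * \<delta>)) \<ge> 0"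
        using sin_consecutive_nonneg[of "j - i - 1"] t(1)
        by (simp add: mult.commute mult.left_commute del: of_int_diff of_int_add)
      then have "Im (cnj (c i - p) * (c j - p)) \<le> 0"
        unfolding cross_vertices[OF p_i] using sin_delta_pos R_pos
        by (simp add: del: of_int_diff of_int_add)
      then show False using support_region_cross[OF p False] cross_swap[of "c i - p" "c j - p"] by linarith
    qed
  qed
  ultimately show "p \<in> billiard_domain c" unfolding billiard_domain_def by blast
qed

lemma outer_billiard_eq: "p \<in> support_region c j \<Longrightarrow> outer_billiard c p = 2 * c j - p"
proof -
  assume p: "p \<in> support_region c j"
  have "support_vertex c p = c j" unfolding support_vertex_def
    using p support_region_unique by (intro the_equality) blast+
  then show ?thesis by (simp add: outer_billiard_def)
qed

end

section \<open>Tiles as intersections of half-planes\<close>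

lemma cis_pi_multiple_periodic: "cis (real_of_int (q + 2 * m) * pi) = cis (real_of_int q * pi)"
  using cis_periodic_int[of "real_of_int q * pi" m] by (simp add: algebra_simps)

context ngon
begin

text \<open>Hence the condition \<open>p \<in> U\<close> in the definition of a tile says that the orbit can be
  continued backwards by one step with support vertex \<open>c j\<close>.\<close>

lemma tile_region_iff: "p \<in> tile_region c j \<longleftrightarrow> 2 * c j - p \<in> support_region c j"
proof -
  have "p = c j + complex_of_real a * (c j - c (j - 1)) + complex_of_real b * (c (j + 1) - c j) \<longleftrightarrow>
     2 * c j - p = c j + complex_of_real a * (c (j - 1) - c j) + complex_of_real b * (c j - c (j + 1))" for a b
    by (auto simp: algebra_simps)
  then show ?thesis unfolding tile_region_def support_region_def by (simp only: mem_Collect_eq)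
qed

text \<open>Under successive reflections in \<open>c (j + l)\<close>, \<open>c (j + 2 l)\<close>, and so on, this point runs
  through the vertices of a star polygon about \<open>z\<close> whose edges have these points as
  midpoints.\<close>

definition tile_centre :: "int \<Rightarrow> nat \<Rightarrow> complex" where
  "tile_centre j l = z + complex_of_real (R / cos (real l * \<delta>)) * cis (\<phi> - (2 * real_of_int j + real l) * \<delta>)"

text \<open>Since \<open>2 * R * sin \<delta>\<close> is the side length \<open>s\<close>, this is \<open>(s / 2) * tan (l * \<delta>)\<close>.\<close>

definition tile_inradius :: "nat \<Rightarrow> real" where
  "tile_inradius l = R * sin \<delta> * tan (real l * \<delta>)"

text \<open>The orbit that \<open>p\<close> would have if its support vertices were \<open>c (j + q * l)\<close> for all
  integers \<open>q\<close>, indexed so that the point with index \<open>q\<close> is reflected in \<open>c (j + q * l)\<close> and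
  \<open>p\<close> has index 1. A reflection in a point reverses the displacement from any other orbit, so
  \<open>p\<close> follows the orbit of the centre at the displacement \<open>p - tile_centre j l\<close> with
  alternating sign.\<close>

definition itinerary :: "int \<Rightarrow> nat \<Rightarrow> complex \<Rightarrow> int \<Rightarrow> complex" where
  "itinerary j l p q = z + cis ((2 - 2 * real_of_int q) * (real l * \<delta>)) * (tile_centre j l - z)
     - cis (real_of_int q * pi) * (p - tile_centre j l)"

lemma itinerary_1: "itinerary j l p 1 = p"
  by (simp add: itinerary_def)

lemma itinerary_step:
  assumes "cos (real l * \<delta>) \<noteq> 0"
  shows "itinerary j l p q + itinerary j l p (q + 1) = 2 * c (j + q * int l)"
proof -
  let ?u = "tile_centre j l - z" and ?L = "real l * \<delta>"
  have pi: "cis (real_of_int (q + 1) * pi) = - cis (real_of_int q * pi)"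
    by (simp add: distrib_right flip: cis_mult)
  have "cis ((2 - 2 * real_of_int q) * ?L) + cis ((2 - 2 * real_of_int (q + 1)) * ?L)
     = 2 * cos ?L * cis ((1 - 2 * real_of_int q) * ?L)"
  proof -
    have "cis (a + b) + cis (a - b) = 2 * complex_of_real (cos b) * cis a" for a b
      by (simp add: complex_eq_iff cos_add cos_diff sin_add sin_diff)
    from this[of "(1 - 2 * real_of_int q) * ?L" ?L] show ?thesis by (simp add: algebra_simps)
  qed
  then have "(cis ((2 - 2 * real_of_int q) * ?L) + cis ((2 - 2 * real_of_int (q + 1)) * ?L)) * ?u
     = 2 * (complex_of_real R * (cis ((1 - 2 * real_of_int q) * ?L) * cis (\<phi> - (2 * real_of_int j + real l) * \<delta>)))"
    using assms by (simp add: tile_centre_def)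
  also have "\<dots> = 2 * (complex_of_real R * cis (\<phi> - 2 * real_of_int (j + q * int l) * \<delta>))"
    unfolding cis_mult by (simp add: algebra_simps)
  finally have *: "(cis ((2 - 2 * real_of_int q) * ?L) + cis ((2 - 2 * real_of_int (q + 1)) * ?L)) * ?u = 2 * (c (j + q * int l) - z)"
    by (simp add: vertex)
  have "itinerary j l p q + itinerary j l p (q + 1) = 2 * z
     + (cis ((2 - 2 * real_of_int q) * ?L) + cis ((2 - 2 * real_of_int (q + 1)) * ?L)) * ?u"
  proof -
    have "(z + a * u - e * x) + (z + b * u - - e * x) = 2 * z + (a + b) * u" for a b e u x
      by (simp add: algebra_simps)
    then show ?thesis unfolding itinerary_def pi .
  qed
  then show ?thesis unfolding * by (simp add: algebra_simps)
qed

lemma itinerary_periodic: "itinerary j l p (q + 2 * int n * m) = itinerary j l p q"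
proof -
  have "(2 - 2 * real_of_int (q + 2 * int n * m)) * (real l * \<delta>)
    = (2 - 2 * real_of_int q) * (real l * \<delta>) + real_of_int (- 2 * m * int l) * (2 * pi)"
    by (simp add: n_delta[symmetric] algebra_simps)
  then have "cis ((2 - 2 * real_of_int (q + 2 * int n * m)) * (real l * \<delta>)) = cis ((2 - 2 * real_of_int q) * (real l * \<delta>))"
    by (simp only: cis_periodic_int)
  moreover have "cis (real_of_int (q + 2 * int n * m) * pi) = cis (real_of_int q * pi)"
    using cis_pi_multiple_periodic[of q "int n * m"] by (simp only: mult.assoc)
  ultimately show ?thesis unfolding itinerary_def by (simp only:)
qed

text
  \<open>At each step, the point on the orbit of the centre has signed distance \<open>tile_inradius l\<close>
  from both lines that bound the support region, counted positive towards the region. So the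
  condition on \<open>p\<close> concerns only its displacement from the centre.\<close>

lemma itinerary_support_iff:
  assumes "cos (real l * \<delta>) \<noteq> 0"
  shows "itinerary j l p q \<in> support_region c (j + q * int l) \<longleftrightarrow>
    cis (\<phi> - (2 * real_of_int (j + q * int l) - 1) * \<delta> + real_of_int q * pi) \<bullet> (p - tile_centre j l) < tile_inradius l \<and>
    cis (\<phi> - (2 * real_of_int (j + q * int l) + 1) * \<delta> + real_of_int (q + 1) * pi) \<bullet> (p - tile_centre j l) < tile_inradius l"
proof -
  let ?w = "tile_centre j l" and ?L = "real l * \<delta>"
  have w: "cis \<theta> \<bullet> (cis ((2 - 2 * real_of_int q) * ?L) * (?w - z))
     = R / cos ?L * cos (\<theta> - \<phi> + (2 * real_of_int (j + q * int l)) * \<delta> - ?L)" for \<theta>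
    unfolding tile_centre_def inner_cis_rotate add_diff_cancel_left' inner_cis_mult_cis
    by (simp add: algebra_simps)
  have rot: "cis \<theta> \<bullet> (cis (real_of_int q * pi) * x) = cis (\<theta> + real_of_int q * pi) \<bullet> x" for \<theta> x
    unfolding inner_cis_rotate using cis_pi_multiple_periodic[of "- q" q] 
    by (simp add: diff_conv_add_uminus flip: cis_mult del: add_uminus_conv_diff)
  have Y: "cis \<theta> \<bullet> (itinerary j l p q - z) 
     = R / cos ?L * cos (\<theta> - \<phi> + (2 * real_of_int (j + q * int l)) * \<delta> - ?L) - cis (\<theta> + real_of_int q * pi) \<bullet> (p - ?w)" for \<theta>
    unfolding itinerary_def rot[symmetric] w[symmetric] inner_diff_right[symmetric] by simp
  have tan: "R / cos ?L * cos (\<delta> - ?L) = R * cos \<delta> + tile_inradius l"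
    "R / cos ?L * cos (- \<delta> - ?L) = R * cos \<delta> - tile_inradius l"
    using assms by (simp_all add: tile_inradius_def tan_def cos_diff field_simps)
  have arg: "\<phi> - (2 * real_of_int (j + q * int l) - 1) * \<delta> - \<phi> + (2 * real_of_int (j + q * int l)) * \<delta> - ?L = \<delta> - ?L"
   "\<phi> - (2 * real_of_int (j + q * int l) + 1) * \<delta> - \<phi> + (2 * real_of_int (j + q * int l)) * \<delta> - ?L = - \<delta> - ?L"
    by (simp_all add: algebra_simps)
  have neg: "cis (\<theta> + real_of_int (q + 1) * pi) = - cis (\<theta> + real_of_int q * pi)" for \<theta>
    by (simp add: distrib_right flip: cis_mult)
  have e: "edge_angle (j + q * int l - 1) = \<phi> - (2 * real_of_int (j + q * int l) - 1) * \<delta>" by simp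
  show ?thesis unfolding support_region_iff e Y arg tan neg by auto
qed

text
  \<open>The orbit is periodic, so it may be extended to all integers; the index 0 accounts for the region \<open>U\<close>.
  The result is an intersection of half-planes at equal distance from the centre, whose
  normals turn by \<open>pi - 2 * l * \<delta>\<close> at each step.\<close>

lemma tile_iff_halfplanes:
  assumes "cos (real l * \<delta>) \<noteq> 0"
  shows "p \<in> tile c j l \<longleftrightarrow> (\<forall>q::int.
    cis (\<phi> - (2 * real_of_int (j + q * int l) - 1) * \<delta> + real_of_int q * pi) \<bullet> (p - tile_centre j l) < tile_inradius l \<and>
    cis (\<phi> - (2 * real_of_int (j + q * int l) + 1) * \<delta> + real_of_int (q + 1) * pi) \<bullet> (p - tile_centre j l) < tile_inradius l)"
proof -
  let ?Y = "itinerary j l p" and ?S = "\<lambda>q. support_region c (j + q * int l)"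
  let ?orb = "\<lambda>i. (outer_billiard c ^^ i) p"
  have step: "?Y (q + 1) = 2 * c (j + q * int l) - ?Y q" for q
    using itinerary_step[OF assms, of j p q] by (simp add: algebra_simps)
  have orb: "?orb i = ?Y (int i + 1)" if "(\<forall>i. ?orb i \<in> ?S (int i + 1)) \<or> (\<forall>i. ?Y (int i + 1) \<in> ?S (int i + 1))" for i
  proof (induction i)
    case 0
    show ?case by (simp add: itinerary_1)
  next
    case (Suc i)
    from that Suc have "?Y (int i + 1) \<in> ?S (int i + 1)" by metis
    then have "?orb (Suc i) = 2 * c (j + (int i + 1) * int l) - ?Y (int i + 1)"
      using Suc outer_billiard_eq by simp
    also have "\<dots> = ?Y (int (Suc i) + 1)" using step[of "int i + 1"] by (simp add: add.commute)
    finally show ?case .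
  qed
  have region: "p \<in> tile_region c j \<longleftrightarrow> ?Y 0 \<in> ?S 0"
  proof -
    have "?Y 0 + p = 2 * c j" using itinerary_step[OF assms, of j p 0] by (simp add: itinerary_1)
    then have "2 * c j - p = ?Y 0" by (metis add_diff_cancel_right')
    then show ?thesis by (simp add: tile_region_iff)
  qed
  have "p \<in> tile c j l \<longleftrightarrow> p \<in> tile_region c j \<and> (\<forall>i. ?orb i \<in> ?S (int i + 1))"
    unfolding tile_def using support_region_subset_domain by blast
  also have "\<dots> \<longleftrightarrow> ?Y 0 \<in> ?S 0 \<and> (\<forall>i. ?Y (int i + 1) \<in> ?S (int i + 1))"
    unfolding region using orb by (metis (lifting))
  also have "\<dots> \<longleftrightarrow> (\<forall>q. ?Y q \<in> ?S q)"
  proof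
    assume h: "?Y 0 \<in> ?S 0 \<and> (\<forall>i. ?Y (int i + 1) \<in> ?S (int i + 1))"
    \<comment> \<open>negative indices are reduced to nonnegative ones by the period \<open>2 * n\<close>\<close>
    have nonneg: "?Y q \<in> ?S q" if "q \<ge> 0" for q
    proof (cases "q = 0")
      case False
      then have "int (nat (q - 1)) + 1 = q" using that by simp
      then show ?thesis using h by metis
    qed (use h in blast)
    show "\<forall>q. ?Y q \<in> ?S q"
    proof
      fix q
      define r where "r = q mod (2 * int n)"
      have q: "q = r + 2 * int n * (q div (2 * int n))" by (simp add: r_def)
      have "r \<ge> 0" using n3 by (simp add: r_def)
      then have "?Y r \<in> ?S r" by (rule nonneg)
      moreover have "?Y q = ?Y r" using itinerary_periodic[of j l p r] q by metis
      moreover have "?S q = ?S r"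
      proof (rule support_region_cong)
        have "j + q * int l - (j + r * int l) = (q - r) * int l" by (simp add: algebra_simps)
        moreover have "q - r = int n * (2 * (q div (2 * int n)))" using q by simp
        ultimately show "int n dvd j + q * int l - (j + r * int l)" by (metis dvd_triv_left dvd_mult2)
      qed
      ultimately show "?Y q \<in> ?S q" by simp
    qed
  qed blast
  finally show ?thesis unfolding itinerary_support_iff[OF assms] .
qed

end

section \<open>Star points and scales\<close>

lemma Re_real_times: "Re (complex_of_real t * x) = t * Re x"
  and Im_real_times: "Im (complex_of_real t * x) = t * Im x"
  by simp_all

text
  \<open>The two conditions on the bottom edge say that its outward normal, which has direction \<open>\<psi> + pi / n\<close>,
  points straight down. This determines the phase.\<close>

lemma standard_ngon_imp_ngon:
  assumes "standard_ngon n c"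
  obtains R where "ngon n 0 R (- (pi / 2) - pi / real n) (pi / real n) c"
proof -
  from assms obtain R \<psi> where n: "n \<ge> 3" and R: "R > 0"
    and c: "\<And>i. c i = complex_of_real R * cis (\<psi> - 2 * pi * real_of_int i / real n)"
    and im: "Im (c (-1)) = Im (c 0)" and re: "Re (c 0) < Re (c (-1))"
    unfolding standard_ngon_def regular_ngon_def by auto
  define \<delta> where "\<delta> = pi / real n"
  define \<alpha> where "\<alpha> = \<psi> + \<delta>"
  have \<delta>: "0 < \<delta>" "\<delta> < pi" using n by (simp_all add: \<delta>_def field_simps)
  then have s: "sin \<delta> > 0" by (rule sin_gt_zero)
  have c0: "c 0 = complex_of_real R * cis (\<alpha> - \<delta>)" and c1: "c (-1) = complex_of_real R * cis (\<alpha> + \<delta>)"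
    by (simp_all add: c \<alpha>_def \<delta>_def field_simps)
  have "cos \<alpha> * sin \<delta> = 0"
    using im R by (simp add: c0 c1 sin_add sin_diff)
  then have "cos \<alpha> = 0" using s by simp
  moreover have "sin \<alpha> * sin \<delta> < 0"
    using re R by (simp add: c0 c1 cos_add cos_diff)
  then have "sin \<alpha> < 0" using s by (simp add: mult_less_0_iff)
  moreover have "(sin \<alpha>)\<^sup>2 = 1" using \<open>cos \<alpha> = 0\<close> sin_cos_squared_add[of \<alpha>] by simp
  ultimately have "cis \<alpha> = cis (- (pi / 2))"
    by (auto simp: complex_eq_iff power2_eq_1_iff)
  have "c i = complex_of_real R * cis (- (pi / 2) - \<delta> - 2 * real_of_int i * \<delta>)" for i
  proof -
    have "c i = complex_of_real R * cis (\<alpha> + (- \<delta> - 2 * real_of_int i * \<delta>))"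
      by (simp add: c \<alpha>_def \<delta>_def algebra_simps)
    also have "\<dots> = complex_of_real R * cis (- (pi / 2) + (- \<delta> - 2 * real_of_int i * \<delta>))"
      by (simp only: \<open>cis \<alpha> = _\<close> flip: cis_mult)
    finally show ?thesis by (simp only: add_diff_eq diff_conv_add_uminus add.assoc)
  qed
  then have "ngon n 0 R (- (pi / 2) - \<delta>) \<delta> c"
    using n R by unfold_locales (simp_all add: \<delta>_def)
  then show ?thesis using that unfolding \<delta>_def by blast
qed

locale standard_polygon = ngon n 0 R "- (pi / 2) - \<delta>" \<delta> c
  for n :: nat and R \<delta> :: real and c :: "int \<Rightarrow> complex"
begin

lemma Re_vertex: "Re (c i) = - R * sin ((2 * real_of_int i + 1) * \<delta>)"
  and Im_vertex: "Im (c i) = - R * cos ((2 * real_of_int i + 1) * \<delta>)"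
proof -
  have "- (pi / 2) - \<delta> - 2 * real_of_int i * \<delta> = - ((2 * real_of_int i + 1) * \<delta> + pi / 2)"
    by (simp add: algebra_simps)
  then have "c i = complex_of_real R * cis (- ((2 * real_of_int i + 1) * \<delta> + pi / 2))"
    using vertex[of i] by (simp only: add_0)
  then show "Re (c i) = - R * sin ((2 * real_of_int i + 1) * \<delta>)" "Im (c i) = - R * cos ((2 * real_of_int i + 1) * \<delta>)"
    by (simp_all add: cos_add sin_add cos_diff sin_diff)
qed

lemma side_length_eq: "side_length c = 2 * R * sin \<delta>"
proof -
  have "dist (c 0) (c 1) = norm (complex_of_real R * (cis (- (pi / 2) - \<delta>) - cis (- (pi / 2) - \<delta> - 2 * \<delta>)))"
    by (simp add: dist_norm vertex right_diff_distrib)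
  also have "\<dots> = 2 * R * sin \<delta>"
    unfolding cis_diff_chord using R_pos sin_delta_pos by (simp add: norm_mult)
  finally show ?thesis by (simp add: side_length_def)
qed

lemma le_num_scales_iff: "j \<le> num_scales n \<longleftrightarrow> 2 * j < n"
  using n3 unfolding num_scales_def by (cases "even n") (auto elim!: evenE oddE)

lemma angle_less: "2 * j < n \<Longrightarrow> real j * \<delta> < pi / 2"
proof -
  assume "2 * j < n"
  then have "real (2 * j) * \<delta> < real n * \<delta>" using delta_pos by (intro mult_strict_right_mono) simp_all
  then show ?thesis unfolding n_delta by simp
qed

lemma tan_less: "i < j \<Longrightarrow> 2 * j < n \<Longrightarrow> tan (real i * \<delta>) < tan (real j * \<delta>)"
proof -
  assume "i < j" "2 * j < n"
  then have "real i * \<delta> < real j * \<delta>" "real j * \<delta> < pi / 2" "- (pi/2) < real i * \<delta>"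
    using delta_pos angle_less by (simp_all add: order_less_le_trans[of "- (pi/2)" 0])
  then show ?thesis by (intro tan_monotone)
qed

lemma tan_eq_iff: "2 * i < n \<Longrightarrow> 2 * j < n \<Longrightarrow> tan (real i * \<delta>) = tan (real j * \<delta>) \<longleftrightarrow> i = j"
  using tan_less[of i j] tan_less[of j i] by (metis nat_neq_iff order_less_irrefl)

lemma tan_le_iff: "2 * i < n \<Longrightarrow> 2 * j < n \<Longrightarrow> tan (real i * \<delta>) \<le> tan (real j * \<delta>) \<longleftrightarrow> i \<le> j"
  using tan_less[of i j] tan_less[of j i] by (metis linorder_neqE_nat not_less order_le_less order_less_imp_le)

lemma tan_pos: "1 \<le> j \<Longrightarrow> 2 * j < n \<Longrightarrow> tan (real j * \<delta>) > 0"
  using tan_less[of 0 j] by simp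

definition star_pt :: "nat \<Rightarrow> complex" where
  "star_pt j = Complex (- R * cos \<delta> * tan (real j * \<delta>)) (- R * cos \<delta>)"

lemma star_pt_inj: "inj_on star_pt {1..num_scales n}"
  using R_pos cos_delta_pos by (auto simp: inj_on_def star_pt_def le_num_scales_iff tan_eq_iff)

lemma star_pt_1: "star_pt 1 = c 0"
  using cos_delta_pos by (simp add: star_pt_def complex_eq_iff Re_vertex Im_vertex tan_def)

lemma Re_vertex_diff: "Re (c i - c (i + 1)) = 2 * R * sin \<delta> * cos (2 * (real_of_int i + 1) * \<delta>)"
  and Im_vertex_diff: "Im (c i - c (i + 1)) = - 2 * R * sin \<delta> * sin (2 * (real_of_int i + 1) * \<delta>)"
proof -
  have a: "(2 * real_of_int i + 1) * \<delta> = 2 * (real_of_int i + 1) * \<delta> - \<delta>"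
   "(2 * real_of_int (i + 1) + 1) * \<delta> = 2 * (real_of_int i + 1) * \<delta> + \<delta>"
    by (simp_all add: algebra_simps)
  show "Re (c i - c (i + 1)) = 2 * R * sin \<delta> * cos (2 * (real_of_int i + 1) * \<delta>)"
   "Im (c i - c (i + 1)) = - 2 * R * sin \<delta> * sin (2 * (real_of_int i + 1) * \<delta>)"
    unfolding minus_complex.sel Re_vertex Im_vertex a cos_add cos_diff sin_add sin_diff
    by (simp_all add: algebra_simps)
qed

lemma closed_trailing_iff:
  "p \<in> insert (c i) (trailing_ext c i) \<longleftrightarrow> (\<exists>t\<ge>0. p = c i + complex_of_real t * (c i - c (i + 1)))"
proof
  assume "p \<in> insert (c i) (trailing_ext c i)"
  then consider "p = c i" | t where "t > 0" "p = c i + complex_of_real t * (c i - c (i + 1))"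
    unfolding trailing_ext_def by blast
  then show "\<exists>t\<ge>0. p = c i + complex_of_real t * (c i - c (i + 1))"
  proof cases
    case 1 then show ?thesis by (intro exI[of _ 0]) simp
  next
    case (2 t) then show ?thesis by (intro exI[of _ t]) simp
  qed
next
  assume "\<exists>t\<ge>0. p = c i + complex_of_real t * (c i - c (i + 1))"
  then obtain t where "t \<ge> 0" "p = c i + complex_of_real t * (c i - c (i + 1))" by blast
  then show "p \<in> insert (c i) (trailing_ext c i)"
    unfolding trailing_ext_def by (cases "t = 0") auto
qed

lemma closed_forward_iff:
  "p \<in> insert (c 0) (forward_ext c (-1)) \<longleftrightarrow> Im p = - R * cos \<delta> \<and> Re p \<le> - R * sin \<delta>"
proof -
  have d: "Re (c 0 - c (-1)) = - 2 * R * sin \<delta>" "Im (c 0 - c (-1)) = 0"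
    using Re_vertex_diff[of "-1"] Im_vertex_diff[of "-1"] by simp_all
  have c0: "Re (c 0) = - R * sin \<delta>" "Im (c 0) = - R * cos \<delta>" by (simp_all add: Re_vertex Im_vertex)
  show ?thesis
  proof
    assume "p \<in> insert (c 0) (forward_ext c (-1))"
    then consider "p = c 0" | t where "t > 0" "p = c 0 + complex_of_real t * (c 0 - c (-1))"
      unfolding forward_ext_def by auto
    then show "Im p = - R * cos \<delta> \<and> Re p \<le> - R * sin \<delta>"
    proof cases
      case 1 then show ?thesis by (simp add: c0)
    next
      case (2 t)
      have "Re p = - R * sin \<delta> + t * (- 2 * R * sin \<delta>)" "Im p = - R * cos \<delta> + t * 0"
        unfolding 2(2) plus_complex.sel Re_real_times Im_real_times d c0 by simp_all
      then show ?thesis using 2(1) R_pos sin_delta_pos by simp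
    qed
  next
    assume h: "Im p = - R * cos \<delta> \<and> Re p \<le> - R * sin \<delta>"
    define t where "t = (- R * sin \<delta> - Re p) / (2 * R * sin \<delta>)"
    have K: "2 * R * sin \<delta> > 0" using R_pos sin_delta_pos by simp
    then have t0: "t \<ge> 0" using h by (simp add: t_def)
    have "t * (2 * R * sin \<delta>) = - R * sin \<delta> - Re p" unfolding t_def using K by (metis nonzero_divide_eq_eq order_less_irrefl)
    then have "p = c 0 + complex_of_real t * (c 0 - c (-1))"
      using h by (intro complex_eqI; unfold plus_complex.sel Re_real_times Im_real_times d c0) simp_all
    then show "p \<in> insert (c 0) (forward_ext c (-1))"
      unfolding forward_ext_def using t0 by (cases "t = 0") auto
  qed
qed

text
  \<open>Coordinates along the outward normal and along the edge, both measured from the centre: the edge extends from \<open>- R * sin \<delta>\<close>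
  to \<open>R * sin \<delta>\<close> in the second one.\<close>

lemma on_edge_line_iff:
  fixes i :: int
  defines "\<eta> \<equiv> 2 * (real_of_int i + 1) * \<delta>"
  shows "p = c i + complex_of_real t * (c i - c (i + 1)) \<longleftrightarrow>
    - Re p * sin \<eta> - Im p * cos \<eta> = R * cos \<delta> \<and>
    Re p * cos \<eta> - Im p * sin \<eta> = R * sin \<delta> + t * (2 * R * sin \<delta>)"
proof -
  define q where "q = c i + complex_of_real t * (c i - c (i + 1))"
  have "(2 * real_of_int i + 1) * \<delta> = \<eta> - \<delta>" by (simp add: \<eta>_def algebra_simps)
  then have q: "Re q = - R * sin (\<eta> - \<delta>) + t * (2 * R * sin \<delta> * cos \<eta>)"
      "Im q = - R * cos (\<eta> - \<delta>) + t * (- 2 * R * sin \<delta> * sin \<eta>)"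
    unfolding q_def plus_complex.sel Re_real_times Im_real_times Re_vertex_diff Im_vertex_diff
    by (simp_all only: Re_vertex Im_vertex \<eta>_def)
  have sc: "(sin \<eta>)\<^sup>2 + (cos \<eta>)\<^sup>2 = 1" by simp
  have "- Re q * sin \<eta> - Im q * cos \<eta> = R * cos \<delta> * ((sin \<eta>)\<^sup>2 + (cos \<eta>)\<^sup>2)"
    unfolding q sin_diff cos_diff by (simp add: power2_eq_square algebra_simps del: sin_cos_squared_add3)
  then have q1: "- Re q * sin \<eta> - Im q * cos \<eta> = R * cos \<delta>" unfolding sc by simp
  have "Re q * cos \<eta> - Im q * sin \<eta> = (R * sin \<delta> + t * (2 * R * sin \<delta>)) * ((sin \<eta>)\<^sup>2 + (cos \<eta>)\<^sup>2)"
    unfolding q sin_diff cos_diff by (simp add: power2_eq_square algebra_simps del: sin_cos_squared_add3)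
  then have q2: "Re q * cos \<eta> - Im q * sin \<eta> = R * sin \<delta> + t * (2 * R * sin \<delta>)" unfolding sc by simp
  have "p = q" if "- Re p * sin \<eta> - Im p * cos \<eta> = - Re q * sin \<eta> - Im q * cos \<eta>"
     "Re p * cos \<eta> - Im p * sin \<eta> = Re q * cos \<eta> - Im q * sin \<eta>"
  proof -
    have x: "((sin \<eta>)\<^sup>2 + (cos \<eta>)\<^sup>2) * Re x = cos \<eta> * (Re x * cos \<eta> - Im x * sin \<eta>) - sin \<eta> * (- Re x * sin \<eta> - Im x * cos \<eta>)"
      "((sin \<eta>)\<^sup>2 + (cos \<eta>)\<^sup>2) * Im x = - cos \<eta> * (- Re x * sin \<eta> - Im x * cos \<eta>) - sin \<eta> * (Re x * cos \<eta> - Im x * sin \<eta>)" for x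
      by (simp_all add: power2_eq_square algebra_simps del: sin_cos_squared_add3)
    have "((sin \<eta>)\<^sup>2 + (cos \<eta>)\<^sup>2) * Re p = ((sin \<eta>)\<^sup>2 + (cos \<eta>)\<^sup>2) * Re q"
      "((sin \<eta>)\<^sup>2 + (cos \<eta>)\<^sup>2) * Im p = ((sin \<eta>)\<^sup>2 + (cos \<eta>)\<^sup>2) * Im q"
      by (simp_all only: x that)
    then show ?thesis by (simp add: complex_eq_iff)
  qed
  then show ?thesis using q1 q2 unfolding q_def[symmetric] by metis
qed

text
  \<open>Two tangents of the incircle meet at equal distances from their points of contact, and their normals enclose the angle \<open>2 * j * \<delta>\<close>;
  this gives the abscissa \<open>- R * cos \<delta> * tan (j * \<delta>)\<close>. For \<open>j\<close> in \<open>{1..n}\<close>, the intersection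
  lies on the ray going left from \<open>c 0\<close> exactly if \<open>j * \<delta> < pi / 2\<close>.\<close>

lemma star_points_eq: "star_points c = star_pt ` {1..num_scales n}"
proof (intro equalityI subsetI)
  fix p assume "p \<in> star_points c"
  then obtain i where p: "p \<in> insert (c i) (trailing_ext c i)" and f: "p \<in> insert (c 0) (forward_ext c (-1))"
    unfolding star_points_def by blast
  \<comment> \<open>the representative in \<open>{1..n}\<close> of \<open>i + 1\<close>, the number of steps from the bottom edge to the edge at \<open>c i\<close>\<close>
  define j where "j = (i mod int n) + 1"
  have j: "1 \<le> j" "j \<le> int n" using n3 pos_mod_sign[of "int n" i] pos_mod_bound[of "int n" i]
    unfolding j_def by linarith+
  define T where "T = real_of_int j * \<delta>"
  have "int n dvd i - (j - 1)" by (simp add: j_def minus_mod_eq_mult_div)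
  moreover have "int n dvd i + 1 - j" by (simp add: j_def minus_mod_eq_mult_div)
  ultimately have "c i = c (j - 1)" "c (i + 1) = c (j - 1 + 1)"
    using vertex_cong[of i "j - 1"] vertex_cong[of "i + 1" j] by simp_all
  then obtain t where t: "t \<ge> 0" "p = c (j - 1) + complex_of_real t * (c (j - 1) - c (j - 1 + 1))"
    using p unfolding closed_trailing_iff by metis
  have eta: "2 * (real_of_int (j - 1) + 1) * \<delta> = 2 * T" by (simp add: T_def)
  have e: "- Re p * sin (2 * T) - Im p * cos (2 * T) = R * cos \<delta>"
    "Re p * cos (2 * T) - Im p * sin (2 * T) = R * sin \<delta> + t * (2 * R * sin \<delta>)"
    using t(2) unfolding on_edge_line_iff eta by simp_all
  have im: "Im p = - R * cos \<delta>" and re: "Re p \<le> - R * sin \<delta>" using f closed_forward_iff by simp_all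
  have "R * sin \<delta> > 0" using R_pos sin_delta_pos by simp
  have "j \<noteq> int n"
  proof
    assume "j = int n"
    then have "2 * T = 2 * pi" using n_delta by (simp add: T_def)
    then have "Re p = R * sin \<delta> + t * (2 * R * sin \<delta>)" using e(2) by simp
    moreover have "t * (2 * R * sin \<delta>) \<ge> 0" using t(1) \<open>R * sin \<delta> > 0\<close> by simp
    ultimately show False using re \<open>R * sin \<delta> > 0\<close> by linarith
  qed
  then have sT: "sin T > 0" unfolding T_def using j by (intro sin_multiple_pos) simp_all
  have "2 * sin T * (- Re p * cos T) = 2 * sin T * (R * cos \<delta> * sin T)"
    using e(1) unfolding im cos_double_sin sin_double by (simp add: power2_eq_square algebra_simps)
  moreover have "2 * sin T \<noteq> 0" using sT by simp
  ultimately have main: "- Re p * cos T = R * cos \<delta> * sin T" using mult_left_cancel by blast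
  have "- Re p > 0" using re \<open>R * sin \<delta> > 0\<close> by simp
  moreover have "- Re p * cos T > 0" unfolding main using R_pos cos_delta_pos sT by simp
  ultimately have cT: "cos T > 0" by (metis zero_less_mult_pos)
  have "T < pi / 2"
  proof (rule ccontr)
    assume "\<not> T < pi / 2"
    moreover have "T \<le> pi" unfolding T_def n_delta[symmetric] using j delta_pos by (intro mult_right_mono) simp_all
    ultimately have "cos T \<le> cos (pi / 2)" by (intro cos_monotone_0_pi_le) simp_all
    then show False using cT by simp
  qed
  then have "real_of_int (2 * j) * \<delta> < real_of_int (int n) * \<delta>" unfolding T_def using n_delta by simp
  then have "2 * j < int n" using delta_pos by (simp only: mult_less_cancel_right of_int_less_iff)
  then have "1 \<le> nat j" "2 * nat j < n" using j by linarith+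
  then have "nat j \<in> {1..num_scales n}" by (simp add: le_num_scales_iff)
  moreover have "p = star_pt (nat j)"
    using im main cT j by (simp add: star_pt_def complex_eq_iff tan_def T_def field_simps)
  ultimately show "p \<in> star_pt ` {1..num_scales n}" by blast
next
  fix p assume "p \<in> star_pt ` {1..num_scales n}"
  then obtain j where j: "1 \<le> j" "2 * j < n" and p: "p = star_pt j" by (auto simp: le_num_scales_iff)
  define T where "T = real j * \<delta>"
  define r where "r = R * cos \<delta>"
  have tan: "R * sin \<delta> \<le> r * tan T"
  proof -
    have "tan \<delta> \<le> tan T" using tan_le_iff[of 1 j] j by (simp add: T_def)
    then have "r * tan \<delta> \<le> r * tan T" using R_pos cos_delta_pos by (simp add: r_def)
    then show ?thesis using cos_delta_pos by (simp add: r_def tan_def)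
  qed
  have s: "R * sin \<delta> > 0" using R_pos sin_delta_pos by simp
  have pc: "Re p = - r * tan T" "Im p = - r" by (simp_all add: p star_pt_def T_def r_def)
  then have "p \<in> insert (c 0) (forward_ext c (-1))" 
    unfolding closed_forward_iff using tan by (simp add: r_def)
  moreover have "p \<in> insert (c (int j - 1)) (trailing_ext c (int j - 1))"
  proof -
    define t where "t = (r * tan T - R * sin \<delta>) / (2 * R * sin \<delta>)"
    have t0: "t \<ge> 0" using tan s by (simp add: t_def)
    have "2 * R * sin \<delta> \<noteq> 0" using R_pos sin_delta_pos by simp
    then have t: "R * sin \<delta> + t * (2 * R * sin \<delta>) = r * tan T" unfolding t_def by (metis nonzero_divide_eq_eq add_diff_cancel_left' add_diff_eq)
    have cT: "cos T > 0" unfolding T_def using angle_less[OF j(2)] delta_pos 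
      by (intro cos_gt_zero_pi) (auto intro: order_less_le_trans[of _ 0])
    have st: "tan T * sin (2 * T) = 1 - cos (2 * T)" 
      using cT by (simp add: tan_def sin_double cos_double_sin power2_eq_square)
    have "tan T * (1 + cos (2 * T)) = sin (2 * T)"
      using cT by (simp add: tan_def sin_double cos_double_cos power2_eq_square)
    then have ct: "tan T * cos (2 * T) = sin (2 * T) - tan T" by (simp add: algebra_simps)
    have eta: "2 * (real_of_int (int j - 1) + 1) * \<delta> = 2 * T" by (simp add: T_def)
    have "p = c (int j - 1) + complex_of_real t * (c (int j - 1) - c (int j - 1 + 1))"
      unfolding on_edge_line_iff eta t pc
    proof
      have "- (- r * tan T) * sin (2 * T) - - r * cos (2 * T) = r * (tan T * sin (2 * T)) + r * cos (2 * T)"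
        by simp
      also have "\<dots> = R * cos \<delta>" unfolding st by (simp add: r_def algebra_simps)
      finally show "- (- r * tan T) * sin (2 * T) - - r * cos (2 * T) = R * cos \<delta>" .
      have "- r * tan T * cos (2 * T) - - r * sin (2 * T) = - r * (tan T * cos (2 * T)) + r * sin (2 * T)"
        by simp
      also have "\<dots> = r * tan T" unfolding ct by (simp add: algebra_simps)
      finally show "- r * tan T * cos (2 * T) - - r * sin (2 * T) = r * tan T" .
    qed
    then show ?thesis using t0 closed_trailing_iff by blast
  qed
  ultimately show "p \<in> star_points c" unfolding star_points_def by blast
qed

lemma dist_star_pt:
  assumes "1 \<le> j" "2 * j < n"
  shows "dist (c 0) (star_pt j) = R * cos \<delta> * (tan (real j * \<delta>) - tan \<delta>)"
proof -
  have "dist (star_pt 1) (star_pt j) = \<bar>R * cos \<delta> * (tan (real j * \<delta>) - tan \<delta>)\<bar>"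
    by (simp add: star_pt_def dist_norm cmod_def right_diff_distrib)
  moreover have "tan \<delta> \<le> tan (real j * \<delta>)" using tan_le_iff[of 1 j] assms by simp
  ultimately show ?thesis using R_pos cos_delta_pos unfolding star_pt_1 by simp
qed

text \<open>The distance from \<open>c 0\<close> increases strictly with \<open>j\<close>, so \<open>star_pt j\<close> is the unique star
  point that has exactly \<open>j\<close> star points, itself included, no farther from \<open>c 0\<close> than it is.\<close>

lemma star_eq:
  assumes "1 \<le> j" "2 * j < n"
  shows "star c j = star_pt j"
proof -
  have count: "card {q \<in> star_points c. dist (c 0) q \<le> dist (c 0) (star_pt i)} = i" if i: "i \<in> {1..num_scales n}" for i
  proof -
    have "{q \<in> star_points c. dist (c 0) q \<le> dist (c 0) (star_pt i)} = star_pt ` {1..i}"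
      using i R_pos cos_delta_pos unfolding star_points_eq
      by (auto simp: dist_star_pt le_num_scales_iff tan_le_iff)
    moreover have "inj_on star_pt {1..i}" using i by (intro inj_on_subset[OF star_pt_inj]) auto
    ultimately show ?thesis by (simp add: card_image)
  qed
  have j: "j \<in> {1..num_scales n}" using assms by (simp add: le_num_scales_iff)
  show ?thesis unfolding star_def
  proof (rule the_equality)
    show "star_pt j \<in> star_points c \<and> card {q \<in> star_points c. dist (c 0) q \<le> dist (c 0) (star_pt j)} = j"
      using j count[OF j] star_points_eq by simp
  next
    fix p assume p: "p \<in> star_points c \<and> card {q \<in> star_points c. dist (c 0) q \<le> dist (c 0) p} = j"
    then obtain i where "i \<in> {1..num_scales n}" "p = star_pt i" unfolding star_points_eq by blast
    then show "p = star_pt j" using p count by metis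
  qed
qed

lemma scale_eq:
  assumes "1 \<le> j" "2 * j < n"
  shows "scale c j = tan \<delta> / tan (real j * \<delta>)"
  unfolding scale_def star_eq[OF assms] side_length_eq
  using R_pos cos_delta_pos by (simp add: star_pt_def tan_def)

lemma card_star_points: "card (star_points c) = num_scales n"
  using card_image[OF star_pt_inj] by (simp add: star_points_eq)

lemma scale_inj: "inj_on (scale c) {1..num_scales n}"
proof (rule inj_onI)
  fix i j assume ij: "i \<in> {1..num_scales n}" "j \<in> {1..num_scales n}" "scale c i = scale c j"
  then have "1 \<le> i" "2 * i < n" "1 \<le> j" "2 * j < n" by (auto simp: le_num_scales_iff)
  moreover have "tan \<delta> > 0" using tan_pos[of 1] n3 by simp
  ultimately show "i = j" using ij(3) tan_pos[of i] tan_pos[of j]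
    by (simp add: scale_eq tan_eq_iff)
qed

lemma card_scales: "card (scales n c) = num_scales n"
  using card_image[OF scale_inj] by (simp add: scales_def)

end

section \<open>Recognising a tile as a regular polygon\<close>

context ngon
begin

text \<open>The shifts \<open>a\<close> and \<open>b\<close> are independent because the two families of half-planes need
  not start at the same edge. It is enough to match the angles exactly, as \<open>\<phi>'\<close> can be chosen
  freely.\<close>

lemma tile_eq_interior_polygon:
  assumes c': "ngon n' z' R' \<phi>' \<delta>' c'"
    and cos: "cos (real l * \<delta>) \<noteq> 0"
    and centre: "tile_centre j l = z'" and inradius: "tile_inradius l = R' * cos \<delta>'"
    and A: "\<And>q. \<phi> - (2 * real_of_int (j + q * int l) - 1) * \<delta> + real_of_int q * pi = \<phi>' - (2 * real_of_int (a - q) + 1) * \<delta>'"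
    and B: "\<And>q. \<phi> - (2 * real_of_int (j + q * int l) + 1) * \<delta> + real_of_int (q + 1) * pi = \<phi>' - (2 * real_of_int (b - q) + 1) * \<delta>'"
  shows "tile c j l = interior (polygon c')"
proof -
  let ?H = "\<lambda>p i. cis (\<phi>' - (2 * real_of_int i + 1) * \<delta>') \<bullet> (p - z') < R' * cos \<delta>'"
  have "p \<in> tile c j l \<longleftrightarrow> (\<forall>q. ?H p (a - q) \<and> ?H p (b - q))" for p
    unfolding tile_iff_halfplanes[OF cos] centre inradius A B ..
  moreover have "(\<forall>q. ?H p (a - q) \<and> ?H p (b - q)) \<longleftrightarrow> (\<forall>i. ?H p i)" for p
    by (metis diff_diff_eq2 add_diff_cancel_left' add.commute)
  ultimately show ?thesis unfolding ngon.interior_polygon[OF c'] by blast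
qed

lemma translate_ngon: "ngon n (w + z) R \<phi> \<delta> (\<lambda>i. w + c i)"
  using n3 R_pos n_delta by unfold_locales (simp_all add: vertex)

lemma interior_polygon_translate: "interior (polygon (\<lambda>i. w + c i)) = (\<lambda>p. w + p) ` interior (polygon c)"
proof -
  have "polygon (\<lambda>i. w + c i) = (\<lambda>p. w + p) ` polygon c"
    unfolding polygon_def by (simp add: convex_hull_translation[symmetric] image_image)
  then show ?thesis by (simp add: interior_translation)
qed

lemma centre_in_interior: "z \<in> interior (polygon c)"
  unfolding interior_polygon using R_pos cos_delta_pos by simp

lemma bounded_polygon: "bounded (polygon c)"
proof -
  have "range c \<subseteq> cball z R" using R_pos by (auto simp: vertex dist_norm norm_mult)
  then have "bounded (range c)" using bounded_cball bounded_subset by blast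
  then show ?thesis unfolding polygon_def by (rule bounded_convex_hull)
qed

end

text \<open>A bounded nonempty set is not invariant under a translation by \<open>a - b \<noteq> 0\<close>, since
  iterating the translation would move a point arbitrarily far.\<close>

lemma translation_unique:
  fixes S :: "'a::real_normed_vector set"
  assumes "bounded S" "S \<noteq> {}" and eq: "(\<lambda>p. a + p) ` S = (\<lambda>p. b + p) ` S"
  shows "a = b"
proof (rule ccontr)
  assume "a \<noteq> b"
  define d where "d = a - b"
  have step: "y + d \<in> S" if "y \<in> S" for y
  proof -
    have "a + y \<in> (\<lambda>p. b + p) ` S" using that unfolding eq[symmetric] by (rule imageI)
    then obtain y' where "y' \<in> S" "a + y = b + y'" by blast
    then have "y' = y + d" by (simp add: d_def algebra_simps)
    then show ?thesis using \<open>y' \<in> S\<close> by simp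
  qed
  obtain x where x: "x \<in> S" using assms(2) by blast
  have shift: "x + real m *\<^sub>R d \<in> S" for m
  proof (induction m)
    case (Suc m)
    have "x + real (Suc m) *\<^sub>R d = (x + real m *\<^sub>R d) + d" by (simp add: scaleR_add_left)
    then show ?case using step[OF Suc] by (simp only:)
  qed (simp add: x)
  obtain B where B: "\<And>y. y \<in> S \<Longrightarrow> norm y \<le> B" using assms(1) by (auto simp: bounded_iff)
  have "norm d > 0" using \<open>a \<noteq> b\<close> by (simp add: d_def)
  then obtain m where m: "B + norm x < real m * norm d" using reals_Archimedean3 by blast
  have "real m * norm d = norm ((x + real m *\<^sub>R d) - x)" by simp
  also have "\<dots> \<le> norm (x + real m *\<^sub>R d) + norm x" by (rule norm_triangle_ineq4)
  also have "\<dots> \<le> B + norm x" using B[OF shift] by simp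
  finally show False using m by simp
qed

section \<open>The First Family of a twice-odd polygon\<close>

locale twice_odd_polygon = standard_polygon "2 * k" R \<delta> P
  for k :: nat and R \<delta> :: real and P :: "int \<Rightarrow> complex" +
  assumes k3: "k \<ge> 3" and k_odd: "odd k"
begin

lemma k_delta: "real k * \<delta> = pi / 2"
  using n_delta by simp

lemma num_scales_2k: "num_scales (2 * k) = k - 1"
  by (simp add: num_scales_def)

lemma tan_complement: "j \<le> k \<Longrightarrow> tan (real (k - j) * \<delta>) = 1 / tan (real j * \<delta>)"
proof -
  assume "j \<le> k"
  then have "real (k - j) * \<delta> = pi / 2 - real j * \<delta>" by (simp add: of_nat_diff left_diff_distrib k_delta)
  then show ?thesis by (simp add: tan_def cos_diff sin_diff)
qed

text \<open>For \<open>l = k - 1\<close> the angle \<open>l * \<delta>\<close> is complementary to \<open>\<delta>\<close>. Hence the tile has the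
  inradius \<open>R * cos \<delta>\<close> of the polygon, and its normals turn by \<open>2 * \<delta>\<close>.\<close>

lemma last_tile: "tile P 0 (k - 1) = (\<lambda>p. Complex (- R / sin \<delta>) 0 + p) ` interior (polygon P)"
proof -
  let ?w = "Complex (- R / sin \<delta>) 0"
  have l: "real (k - 1) * \<delta> = pi / 2 - \<delta>" using k3 by (simp add: of_nat_diff left_diff_distrib k_delta)
  have pi: "pi = 2 * real k * \<delta>" using k_delta by simp
  have km: "real (k - 1) = real k - 1" using k3 by simp
  have cos: "cos (real (k - 1) * \<delta>) = sin \<delta>" unfolding l by (simp add: cos_diff)
  have "tile P 0 (k - 1) = interior (polygon (\<lambda>i. ?w + P i))"
  proof (rule tile_eq_interior_polygon[OF translate_ngon, of _ _ _ "-1" "- int k"])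
    show "cos (real (k - 1) * \<delta>) \<noteq> 0" unfolding cos using sin_delta_pos by simp
    show "tile_inradius (k - 1) = R * cos \<delta>"
      unfolding tile_inradius_def l using sin_delta_pos by (simp add: tan_def cos_diff sin_diff)
    have "tile_centre 0 (k - 1) = complex_of_real (R / sin \<delta>) * cis (- pi)"
    proof -
      have "- (pi / 2) - \<delta> - (2 * real_of_int 0 + real (k - 1)) * \<delta> = - pi" using l by simp
      then show ?thesis unfolding tile_centre_def cos by (simp only: add_0)
    qed
    then show "tile_centre 0 (k - 1) = ?w + 0" by (simp add: complex_eq_iff)
  next
    fix q :: int
    show "- (pi / 2) - \<delta> - (2 * real_of_int (0 + q * int (k - 1)) - 1) * \<delta> + real_of_int q * pi
        = - (pi / 2) - \<delta> - (2 * real_of_int (- 1 - q) + 1) * \<delta>"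
      unfolding of_int_add of_int_mult of_int_of_nat_eq km pi by (simp add: algebra_simps)
    show "- (pi / 2) - \<delta> - (2 * real_of_int (0 + q * int (k - 1)) + 1) * \<delta> + real_of_int (q + 1) * pi
        = - (pi / 2) - \<delta> - (2 * real_of_int (- int k - q) + 1) * \<delta>"
      unfolding of_int_add of_int_mult of_int_of_nat_eq km pi by (simp add: algebra_simps)
  qed
  then show ?thesis by (simp add: interior_polygon_translate)
qed

lemma cD_eq: "cD (2 * k) P = Complex (- R / sin \<delta>) 0"
  unfolding cD_def D_tile_def num_scales_2k last_tile
proof (rule the_equality)
  fix w assume "(\<lambda>p. Complex (- R / sin \<delta>) 0 + p) ` interior (polygon P) = (\<lambda>p. w + p) ` interior (polygon P)"
  then show "w = Complex (- R / sin \<delta>) 0"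
    using translation_unique[of "interior (polygon P)"] centre_in_interior bounded_polygon
      bounded_subset[OF _ interior_subset] by (metis empty_iff)
qed simp

text \<open>The tile \<open>S[k - 2]\<close> will be the interior of a regular \<open>k\<close>-gon \<open>M\<close>, with this centre.
  The mirror symmetry of the First Family comes from its abscissa being half of that of \<open>cD\<close>.\<close>

definition M_centre :: complex where
  "M_centre = Complex (- R / (2 * sin \<delta>)) (- R / (2 * cos \<delta>))"

definition M_polygon :: "int \<Rightarrow> complex" where
  "M_polygon i = M_centre + complex_of_real (R / (2 * cos \<delta>)) * cis (- (pi / 2) - 2 * \<delta> - 2 * real_of_int i * (2 * \<delta>))"

lemma M_ngon: "ngon k M_centre (R / (2 * cos \<delta>)) (- (pi / 2) - 2 * \<delta>) (2 * \<delta>) M_polygon"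
  using k3 k_delta R_pos cos_delta_pos by unfold_locales (simp_all add: M_polygon_def)

lemma M_centre_polar: "M_centre = complex_of_real (R / sin (2 * \<delta>)) * cis (\<delta> - pi)"
  using sin_delta_pos cos_delta_pos by (simp add: M_centre_def complex_eq_iff sin_double cos_diff sin_diff)

lemma side_length_M: "side_length M_polygon = side_length P"
proof -
  have "dist (M_polygon 0) (M_polygon 1) = norm (complex_of_real (R / (2 * cos \<delta>)) * 
      (cis (- (pi / 2) - 2 * \<delta>) - cis (- (pi / 2) - 2 * \<delta> - 2 * (2 * \<delta>))))"
    by (simp add: dist_norm M_polygon_def right_diff_distrib)
  also have "\<dots> = R / (2 * cos \<delta>) * (2 * sin (2 * \<delta>))"
  proof -
    have "R / (2 * cos \<delta>) > 0" using R_pos cos_delta_pos by simp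
    then have "norm (complex_of_real (R / (2 * cos \<delta>))) = R / (2 * cos \<delta>)" by (simp only: norm_of_real abs_of_pos)
    then show ?thesis unfolding cis_diff_chord norm_mult using sin_2delta_pos by simp
  qed
  also have "\<dots> = 2 * R * sin \<delta>" using cos_delta_pos by (simp add: sin_double)
  finally show ?thesis by (simp add: side_length_def[of M_polygon] side_length_eq)
qed

text \<open>For \<open>l = k - 2\<close> the normals turn by \<open>4 * \<delta>\<close>, the exterior angle of a regular \<open>k\<close>-gon.
  The two families of half-planes differ by a half turn, which is \<open>k\<close> steps of \<open>2 * \<delta>\<close>, less
  one such step. Since \<open>k\<close> is odd, the difference is a multiple of \<open>4 * \<delta>\<close> and the families
  coincide; for even \<open>k\<close> they would interleave.\<close>

lemma penultimate_tile: "tile P 0 (k - 2) = interior (polygon M_polygon)"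
proof (rule tile_eq_interior_polygon[OF M_ngon, of _ _ "-1" "- 1 - int (k div 2)"])
  have l: "real (k - 2) * \<delta> = pi / 2 - 2 * \<delta>" using k3 by (simp add: of_nat_diff left_diff_distrib k_delta)
  have cos: "cos (real (k - 2) * \<delta>) = sin (2 * \<delta>)" unfolding l by (simp add: cos_diff)
  show "cos (real (k - 2) * \<delta>) \<noteq> 0" unfolding cos using sin_2delta_pos by simp
  show "tile_inradius (k - 2) = R / (2 * cos \<delta>) * cos (2 * \<delta>)"
    unfolding tile_inradius_def l using sin_delta_pos cos_delta_pos
    by (simp add: tan_def cos_diff sin_diff sin_double)
  show "tile_centre 0 (k - 2) = M_centre"
  proof -
    have "- (pi / 2) - \<delta> - (2 * real_of_int 0 + real (k - 2)) * \<delta> = \<delta> - pi" using l by simp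
    then show ?thesis unfolding tile_centre_def M_centre_polar cos by (simp only: add_0)
  qed
  fix q :: int
  define e where "e = k div 2"
  have k: "k = 2 * e + 1" unfolding e_def using k_odd by simp
  have km: "real (k - 2) = 2 * real e - 1" using k k3 by (simp add: of_nat_diff)
  have pi: "pi = (4 * real e + 2) * \<delta>" using k k_delta by (simp add: algebra_simps)
  show "- (pi / 2) - \<delta> - (2 * real_of_int (0 + q * int (k - 2)) - 1) * \<delta> + real_of_int q * pi
      = - (pi / 2) - 2 * \<delta> - (2 * real_of_int (- 1 - q) + 1) * (2 * \<delta>)"
    unfolding of_int_add of_int_mult of_int_of_nat_eq km pi by (simp add: algebra_simps)
  show "- (pi / 2) - \<delta> - (2 * real_of_int (0 + q * int (k - 2)) + 1) * \<delta> + real_of_int (q + 1) * pi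
      = - (pi / 2) - 2 * \<delta> - (2 * real_of_int (- 1 - int (k div 2) - q) + 1) * (2 * \<delta>)"
    unfolding of_int_add of_int_diff of_int_mult of_int_of_nat_eq km pi e_def[symmetric] by (simp add: algebra_simps)
qed

text \<open>For the \<open>k\<close>-gon and \<open>l = k div 2\<close> the normals turn by \<open>2 * \<delta>\<close>, half of the exterior
  angle, which yields a \<open>2 * k\<close>-gon. The index of the starting vertex is the one for which the
  centre of the tile falls on the origin.\<close>

lemma D_tile_of_M: "D_tile k M_polygon (- int (k div 2) - 1) = interior (polygon P)"
proof -
  interpret M: ngon k M_centre "R / (2 * cos \<delta>)" "- (pi / 2) - 2 * \<delta>" "2 * \<delta>" M_polygon
    by (rule M_ngon)
  define e where "e = k div 2"
  have num: "num_scales k = e" using k_odd by (simp add: num_scales_def e_def)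
  have k: "real k = 2 * real e + 1" unfolding e_def using k_odd by (metis odd_two_times_div_two_succ of_nat_add of_nat_mult of_nat_numeral of_nat_1)
  have l: "real e * (2 * \<delta>) = pi / 2 - \<delta>" using k_delta k by (simp add: algebra_simps)
  have pi: "pi = 4 * real e * \<delta> + 2 * \<delta>" using l by simp
  show ?thesis unfolding D_tile_def num e_def[symmetric]
  proof (rule M.tile_eq_interior_polygon[OF ngon_axioms, of _ _ "- 2 * int e - 3" "- 4 * int e - 2"])
    have cos: "cos (real e * (2 * \<delta>)) = sin \<delta>" unfolding l by (simp add: cos_diff)
    show "cos (real e * (2 * \<delta>)) \<noteq> 0" unfolding cos using sin_delta_pos by simp
    show "M.tile_inradius e = R * cos \<delta>"
      unfolding M.tile_inradius_def l using sin_delta_pos cos_delta_pos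
      by (simp add: tan_def cos_diff sin_diff sin_double)
    show "M.tile_centre (- int e - 1) e = 0"
    proof -
      have "- (pi / 2) - 2 * \<delta> - (2 * real_of_int (- int e - 1) + real e) * (2 * \<delta>) = \<delta>"
        using pi by (simp add: algebra_simps)
      then have "M.tile_centre (- int e - 1) e = M_centre + complex_of_real (R / sin (2 * \<delta>)) * cis \<delta>"
        unfolding M.tile_centre_def cos by (simp only:) (simp add: sin_double)
      then show ?thesis unfolding M_centre_polar by (simp add: complex_eq_iff cos_diff sin_diff)
    qed
    fix q :: int
    have q: "real_of_int q * pi = real_of_int q * (4 * real e * \<delta> + 2 * \<delta>)" using pi by simp
    show "- (pi / 2) - 2 * \<delta> - (2 * real_of_int (- int e - 1 + q * int e) - 1) * (2 * \<delta>) + real_of_int q * pi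
       = - (pi / 2) - \<delta> - (2 * real_of_int (- 2 * int e - 3 - q) + 1) * \<delta>"
      unfolding q by (simp add: algebra_simps)
    have q1: "real_of_int (q + 1) * pi = real_of_int (q + 1) * (4 * real e * \<delta> + 2 * \<delta>)" using pi by simp
    show "- (pi / 2) - 2 * \<delta> - (2 * real_of_int (- int e - 1 + q * int e) + 1) * (2 * \<delta>) + real_of_int (q + 1) * pi
       = - (pi / 2) - \<delta> - (2 * real_of_int (- 4 * int e - 2 - q) + 1) * \<delta>"
      unfolding q1 by (simp add: algebra_simps)
  qed
qed

text \<open>Both maps reverse the abscissa and keep the ordinate. They agree because \<open>cD\<close> has
  ordinate 0 and twice the abscissa of the centre of \<open>M\<close>, so no other tile has to be
  computed.\<close>

lemma reflection_tile: "vertical_reflection M_centre ` tile P 0 j = DS (2 * k) P j"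
proof -
  have "vertical_reflection M_centre p = cD (2 * k) P + Complex (- Re p) (Im p)" for p
    by (simp add: vertical_reflection_def M_centre_def cD_eq complex_eq_iff)
  then show ?thesis unfolding DS_def by (intro image_cong) simp_all
qed

lemma reflection_DS: "vertical_reflection M_centre ` DS (2 * k) P j = tile P 0 j"
proof -
  have "vertical_reflection M_centre (vertical_reflection M_centre p) = p" for p
    by (simp add: vertical_reflection_def)
  then show ?thesis unfolding reflection_tile[symmetric] by (simp add: image_image)
qed

lemma reflection_first_family:
  "(\<lambda>X. vertical_reflection M_centre ` X) ` first_family (2 * k) P = first_family (2 * k) P"
  unfolding first_family_def image_Un image_image reflection_tile reflection_DS by (rule Un_commute)

end

section \<open>Comparison of the scales\<close>

context twice_odd_polygon
begin

lemma scale_P: "j \<in> {1..k - 1} \<Longrightarrow> scale P j = tan \<delta> / tan (real j * \<delta>)"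
  using k3 by (intro scale_eq) auto

lemma tan_multiple_pos: "j \<in> {1..k - 1} \<Longrightarrow> tan (real j * \<delta>) > 0"
  using k3 by (intro tan_pos) auto

lemma tan_delta_pos: "tan \<delta> > 0"
  using tan_multiple_pos[of 1] k3 by simp

lemma scale_P_pos: "j \<in> {1..k - 1} \<Longrightarrow> scale P j > 0"
  using tan_multiple_pos tan_delta_pos by (simp add: scale_P)

lemma scale_P_inj: "inj_on (scale P) {1..k - 1}"
  using scale_inj unfolding num_scales_2k .

text \<open>\<open>scale P j\<close> is \<open>tan \<delta>\<close> divided by \<open>tan (j * \<delta>)\<close>, and \<open>j * \<delta>\<close> and \<open>(k - j) * \<delta>\<close> are
  complementary, so that their tangents are reciprocal.\<close>

lemma GenScale_div_scale:
  assumes j: "j \<in> {1..k - 1}"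
  shows "GenScale (2 * k) P / scale P j = scale P (k - j)"
proof -
  have "k - 1 \<in> {1..k - 1}" "k - j \<in> {1..k - 1}" using j k3 by auto
  moreover have "tan (real (k - 1) * \<delta>) = 1 / tan \<delta>" using tan_complement[of 1] k3 by simp
  moreover have "tan (real (k - j) * \<delta>) = 1 / tan (real j * \<delta>)" using tan_complement[of j] j by auto
  ultimately have "scale P (k - 1) = tan \<delta> * tan \<delta>" "scale P (k - j) = tan \<delta> * tan (real j * \<delta>)"
    by (simp_all only: scale_P) simp_all
  then show ?thesis using j tan_delta_pos by (simp add: GenScale_def num_scales_2k scale_P)
qed

lemma scale_class_scale: "j \<in> {1..k - 1} \<Longrightarrow> scale_class (2 * k) P (scale P j) = {scale P j, scale P (k - j)}"
  by (simp add: scale_class_def GenScale_div_scale)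

lemma odd_scales_image: "odd_scales (2 * k) P = (\<lambda>n. scale P (2 * n - 1)) ` {1..k div 2}"
proof -
  have "{j \<in> {1..k - 1}. odd j} = (\<lambda>n. 2 * n - 1) ` {1..k div 2}"
  proof (intro equalityI subsetI)
    fix j assume "j \<in> {j \<in> {1..k - 1}. odd j}"
    then have "(j + 1) div 2 \<in> {1..k div 2}" "j = 2 * ((j + 1) div 2) - 1" by (auto elim: oddE)
    then show "j \<in> (\<lambda>n. 2 * n - 1) ` {1..k div 2}" by blast
  qed (use k_odd in \<open>auto elim!: oddE\<close>)
  then show ?thesis unfolding odd_scales_def num_scales_2k by (simp add: image_image)
qed

text \<open>A class consists of the scales with indices \<open>j\<close> and \<open>k - j\<close>. As \<open>k\<close> is odd, exactly
  one of the two indices is odd.\<close>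

lemma bij_scale_class: "bij_betw (scale_class (2 * k) P) (odd_scales (2 * k) P) (effective_scales (2 * k) P)"
  unfolding bij_betw_def
proof
  show "inj_on (scale_class (2 * k) P) (odd_scales (2 * k) P)"
    unfolding odd_scales_def num_scales_2k
  proof (rule inj_onI; clarify)
    fix i j assume ij: "i \<in> {1..k - 1}" "odd i" "j \<in> {1..k - 1}" "odd j"
      and eq: "scale_class (2 * k) P (scale P i) = scale_class (2 * k) P (scale P j)"
    have "scale P i = scale P j \<or> scale P i = scale P (k - j)"
      using eq ij by (auto simp: scale_class_scale doubleton_eq_iff)
    moreover have "k - j \<in> {1..k - 1}" using ij by auto
    ultimately have "i = j \<or> i = k - j" using scale_P_inj ij by (auto dest: inj_onD)
    moreover have "even (k - j)" using ij k_odd by auto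
    ultimately show "scale P i = scale P j" using ij by auto
  qed
  show "scale_class (2 * k) P ` odd_scales (2 * k) P = effective_scales (2 * k) P"
    unfolding odd_scales_def effective_scales_def scales_def num_scales_2k
  proof (intro equalityI subsetI; clarify)
    fix j assume j: "j \<in> {1..k - 1}"
    show "scale_class (2 * k) P (scale P j) \<in> scale_class (2 * k) P ` scale P ` {j \<in> {1..k - 1}. odd j}"
    proof (cases "odd j")
      case False
      have m: "k - j \<in> {1..k - 1}" "odd (k - j)" "k - (k - j) = j" using j False k_odd by auto
      then have "scale_class (2 * k) P (scale P (k - j)) = scale_class (2 * k) P (scale P j)"
        unfolding scale_class_scale[OF j] scale_class_scale[OF m(1)] m(3) by blast
      then show ?thesis using m by (metis (mono_tags, lifting) image_eqI mem_Collect_eq)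
    qed (use j in blast)
  qed blast
qed

lemma inj_odd_index: "inj_on (\<lambda>n. scale P (2 * n - 1)) {1..k div 2}"
proof (rule inj_onI)
  fix m n assume mn: "m \<in> {1..k div 2}" "n \<in> {1..k div 2}" "scale P (2 * m - 1) = scale P (2 * n - 1)"
  have "2 * m - 1 \<in> {1..k - 1}" "2 * n - 1 \<in> {1..k - 1}" using mn by auto
  then have "2 * m - 1 = 2 * n - 1" using scale_P_inj mn(3) by (auto dest: inj_onD)
  then show "m = n" using mn by auto
qed

lemma card_effective_scales: "card (effective_scales (2 * k) P) = k div 2"
  using bij_betw_same_card[OF bij_scale_class] card_image[OF inj_odd_index] by (simp add: odd_scales_image)

end

locale twice_odd_pair = twice_odd_polygon k R \<delta> P + Q: standard_polygon k R' "2 * \<delta>" Q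
  for k :: nat and R \<delta> R' :: real and P Q :: "int \<Rightarrow> complex"
begin

lemma num_scales_k: "num_scales k = k div 2"
  using k_odd by (simp add: num_scales_def)

lemma scale_Q: "i \<in> {1..k div 2} \<Longrightarrow> scale Q i = tan (2 * \<delta>) / tan (real (2 * i) * \<delta>)"
  using Q.scale_eq[of i] k_odd by (auto elim!: oddE simp: mult_ac)

lemma GenScale_Q: "GenScale k Q = tan (2 * \<delta>) * tan \<delta>"
proof -
  have "k div 2 \<in> {1..k div 2}" "2 * (k div 2) = k - 1" using k3 k_odd by (auto elim: oddE)
  then show ?thesis using scale_Q[of "k div 2"] tan_complement[of 1] k3
    unfolding GenScale_def num_scales_k by simp
qed

lemma penultimate_scale: "scale P (k - 2) = GenScale k Q"
proof -
  have "k - 2 \<in> {1..k - 1}" using k3 by auto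
  then show ?thesis using tan_complement[of 2] k3 by (simp add: scale_P GenScale_Q)
qed

text \<open>In units of \<open>\<delta>\<close>, a quarter of the central angle of the \<open>k\<close>-gon, the two angles
  involved are \<open>2 * n - 1\<close> and \<open>2 * (k div 2 - n + 1) = k - (2 * n - 1)\<close>; they are
  complementary.\<close>

lemma GenScale_Q_div_scale:
  assumes n: "n \<in> {1..k div 2}"
  shows "GenScale k Q / scale P (2 * n - 1) = scale Q (k div 2 - n + 1)"
proof -
  have j: "2 * n - 1 \<in> {1..k - 1}" and i: "k div 2 - n + 1 \<in> {1..k div 2}" 
    and e: "2 * (k div 2 - n + 1) = k - (2 * n - 1)" using n k_odd by (auto elim!: oddE)
  have "tan (real (2 * (k div 2 - n + 1)) * \<delta>) = 1 / tan (real (2 * n - 1) * \<delta>)"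
    unfolding e using j by (intro tan_complement) auto
  then show ?thesis
    unfolding scale_Q[OF i] scale_P[OF j] GenScale_Q using tan_delta_pos by simp
qed

lemma bij_scales: "bij_betw (\<lambda>x. GenScale k Q / x) (odd_scales (2 * k) P) (scales k Q)"
  unfolding bij_betw_def
proof
  have "tan (2 * \<delta>) > 0" using tan_multiple_pos[of 2] k3 by simp
  then have "GenScale k Q > 0" using tan_delta_pos by (simp add: GenScale_Q)
  moreover have "x \<noteq> 0" if "x \<in> odd_scales (2 * k) P" for x
    using that scale_P_pos unfolding odd_scales_def num_scales_2k by fastforce
  ultimately show "inj_on (\<lambda>x. GenScale k Q / x) (odd_scales (2 * k) P)"
    by (intro inj_onI) (auto simp: field_simps)
  have "(\<lambda>x. GenScale k Q / x) ` odd_scales (2 * k) P = (\<lambda>n. scale Q (k div 2 - n + 1)) ` {1..k div 2}"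
    unfolding odd_scales_image image_image using GenScale_Q_div_scale by (intro image_cong) auto
  also have "\<dots> = scale Q ` (\<lambda>n. k div 2 - n + 1) ` {1..k div 2}" by (simp only: image_image)
  also have "(\<lambda>n. k div 2 - n + 1) ` {1..k div 2} = {1..k div 2}"
  proof (intro equalityI subsetI)
    fix i assume "i \<in> {1..k div 2}"
    then have "k div 2 - i + 1 \<in> {1..k div 2}" "i = k div 2 - (k div 2 - i + 1) + 1" by auto
    then show "i \<in> (\<lambda>n. k div 2 - n + 1) ` {1..k div 2}" by (rule rev_image_eqI)
  qed auto
  finally show "(\<lambda>x. GenScale k Q / x) ` odd_scales (2 * k) P = scales k Q"
    by (simp add: scales_def num_scales_k)
qed

end

theorem mainTheorem2:
  fixes k :: nat and s :: real and P Q :: "int \<Rightarrow> complex"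
  assumes "k \<ge> 3" and "odd k"
    and "standard_ngon (2 * k) P" and "side_length P = s"
    and "standard_ngon k Q"
  shows "card (star_points P) = k - 1 \<and> card (scales (2 * k) P) = k - 1
    \<and> scale P (k - 1) = GenScale (2 * k) P
    \<and> scale P (k - 2) = GenScale k Q
    \<and> (\<exists>z M. regular_ngon k z M \<and> side_length M = s
         \<and> tile P 0 (k - 2) = interior (polygon M)
         \<and> (\<exists>j. D_tile k M j = interior (polygon P))
         \<and> (\<forall>j\<in>{1..k - 1}.
              vertical_reflection z ` tile P 0 j = DS (2 * k) P j \<and>
              vertical_reflection z ` DS (2 * k) P j = tile P 0 j)
         \<and> (\<lambda>X. vertical_reflection z ` X) ` first_family (2 * k) P = first_family (2 * k) P)
    \<and> card (effective_scales (2 * k) P) = k div 2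
    \<and> bij_betw (scale_class (2 * k) P) (odd_scales (2 * k) P) (effective_scales (2 * k) P)
    \<and> bij_betw (\<lambda>x. GenScale k Q / x) (odd_scales (2 * k) P) (scales k Q)
    \<and> card (scales k Q) = k div 2
    \<and> (\<forall>n\<in>{1..k div 2}.
         GenScale k Q / scale P (2 * n - 1) = scale Q (k div 2 - n + 1))"
proof -
  define \<delta> where "\<delta> = pi / real (2 * k)"
  have \<delta>_k: "pi / real k = 2 * \<delta>" by (simp add: \<delta>_def)
  obtain R where P: "ngon (2 * k) 0 R (- (pi / 2) - \<delta>) \<delta> P"
    using standard_ngon_imp_ngon[OF assms(3)] unfolding \<delta>_def by blast
  obtain R' where Q: "ngon k 0 R' (- (pi / 2) - 2 * \<delta>) (2 * \<delta>) Q"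
    using standard_ngon_imp_ngon[OF assms(5)] unfolding \<delta>_k by blast
  interpret twice_odd_pair k R \<delta> R' P Q
    using P Q assms(1,2)
    by (simp add: twice_odd_pair_def twice_odd_polygon_def twice_odd_polygon_axioms_def standard_polygon_def)
  have M: "regular_ngon k M_centre M_polygon"
  proof -
    have "M_polygon i = M_centre + complex_of_real (R / (2 * cos \<delta>)) * cis (- (pi / 2) - 2 * \<delta> - 2 * pi * real_of_int i / real k)" for i
    proof -
      have "2 * real_of_int i * (2 * \<delta>) = 2 * pi * real_of_int i / real k" by (simp flip: \<delta>_k)
      then show ?thesis unfolding M_polygon_def by (simp only:)
    qed
    moreover have "R / (2 * cos \<delta>) > 0" using R_pos cos_delta_pos by simp
    ultimately show ?thesis unfolding regular_ngon_def using assms(1) by blast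
  qed
  have "card (star_points P) = k - 1" "card (scales (2 * k) P) = k - 1"
    using card_star_points card_scales num_scales_2k by simp_all
  moreover have "scale P (k - 1) = GenScale (2 * k) P" by (simp add: GenScale_def num_scales_2k)
  moreover have "card (scales k Q) = k div 2" using Q.card_scales num_scales_k by simp
  moreover have "side_length M_polygon = s" using side_length_M assms(4) by simp
  ultimately show ?thesis
    using M penultimate_scale penultimate_tile D_tile_of_M reflection_tile reflection_DS
      reflection_first_family card_effective_scales bij_scale_class bij_scales GenScale_Q_div_scale
    by blast
qed

end
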